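(* For every $\beta\in\mathbb{R}$ and every continuous function $f:[0,1]\times[0,1]\to\mathbb{R}$, $$ \lim_{\epsilon\downarrow 0}\ \lim_{n\to\infty}\ \mathbb{P}_n^{1-\beta/n}\left\{\pi\in S_n:\ \left|\frac1n\sum_{i=1}^n f\!\left(\frac in,\frac{\pi_i}{n}\right)-\int_{[0,1]\times[0,1]} f(x,y)\,u(x,y)\,dx\,dy\right|>\epsilon\right\}=0, $$ where $$ u(x,y)=\frac{(\beta/2)\sinh(\beta/2)}{\big(e^{\beta/4}\cosh(\beta[x-y]/2)-e^{-\beta/4}\cosh(\beta[x+y-1]/2)\big)^2} $$ for $\beta\neq0$, and $u\equiv1$ (the limit as $\beta\to0$ of this expression) for $\beta=0$.
   Context: For $q>0$ and $n\ge1$, the Mallows measure $\mathbb{P}_n^q$ is the probability measure on the symmetric group $S_n$ given by $\mathbb{P}_n^q(\pi)=q^{d(\pi,e)}/P_n(q)$, where $d(\pi,e)=|\{(i,j)\in\mathbb{Z}^2:1\le i<j\le n,\ \pi_i>\pi_j\}|$ is the number of inversions of $\pi=(\pi_1,\dots,\pi_n)$ and $P_n(q)=\sum_{\pi\in S_n}q^{d(\pi,e)}$ is the normalization. For given $\beta$, the measure $\mathbb{P}_n^{1-\beta/n}$ is considered for $n$ large enough that $1-\beta/n>0$. *)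

theory Defs
  imports "HOL-Probability.Probability" "HOL-Combinatorics.Permutations"
begin

text \<open>The symmetric group on n letters is the set of functions that permute \<open>{1..n}\<close>
  (and are the identity outside of it).\<close>

definition inversions :: "nat \<Rightarrow> (nat \<Rightarrow> nat) \<Rightarrow> nat" where
  "inversions n \<pi> = card {(i, j). 1 \<le> i \<and> i < j \<and> j \<le> n \<and> \<pi> i > \<pi> j}"

definition mallows_norm :: "nat \<Rightarrow> real \<Rightarrow> real" where
  "mallows_norm n q = (\<Sum>\<pi> | \<pi> permutes {1..n}. q ^ inversions n \<pi>)"

text \<open>Only meaningful for \<open>q > 0\<close>; see \<open>prob_space_mallows\<close>.\<close>

definition mallows :: "nat \<Rightarrow> real \<Rightarrow> (nat \<Rightarrow> nat) measure" where
  "mallows n q = point_measure {\<pi>. \<pi> permutes {1..n}}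
     (\<lambda>\<pi>. ennreal (q ^ inversions n \<pi> / mallows_norm n q))"

lemma space_mallows [simp]: "space (mallows n q) = {\<pi>. \<pi> permutes {1..n}}"
  by (simp add: mallows_def space_point_measure)

lemma sets_mallows [simp]: "sets (mallows n q) = Pow {\<pi>. \<pi> permutes {1..n}}"
  by (simp add: mallows_def sets_point_measure)

lemma mallows_norm_pos: "q > 0 \<Longrightarrow> mallows_norm n q > 0"
  unfolding mallows_norm_def
  by (rule sum_pos) (auto intro: finite_permutations permutes_id)

lemma measure_mallows:
  assumes "q > 0" "A \<subseteq> {\<pi>. \<pi> permutes {1..n}}"
  shows "measure (mallows n q) A = (\<Sum>\<pi>\<in>A. q ^ inversions n \<pi>) / mallows_norm n q"
proof -
  have "emeasure (mallows n q) A
      = (\<Sum>\<pi>\<in>A. ennreal (q ^ inversions n \<pi> / mallows_norm n q))"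
    unfolding mallows_def using assms
    by (intro emeasure_point_measure_finite finite_permutations) auto
  also have "\<dots> = ennreal (\<Sum>\<pi>\<in>A. q ^ inversions n \<pi> / mallows_norm n q)"
    using assms mallows_norm_pos[of q n] by (intro sum_ennreal) auto
  finally show ?thesis
    using assms mallows_norm_pos[of q n]
    by (simp add: measure_def sum_nonneg sum_divide_distrib)
qed

lemma prob_space_mallows:
  assumes "q > 0"
  shows "prob_space (mallows n q)"
proof
  have "emeasure (mallows n q) (space (mallows n q))
      = (\<Sum>\<pi> | \<pi> permutes {1..n}. ennreal (q ^ inversions n \<pi> / mallows_norm n q))"
    unfolding space_mallows unfolding mallows_def
    by (intro emeasure_point_measure_finite finite_permutations) auto
  also have "\<dots> = ennreal (\<Sum>\<pi> | \<pi> permutes {1..n}. q ^ inversions n \<pi> / mallows_norm n q)"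
    using assms mallows_norm_pos[of q n] by (intro sum_ennreal) auto
  also have "\<dots> = 1"
    using mallows_norm_pos[OF assms, of n]
    by (simp add: mallows_norm_def flip: sum_divide_distrib)
  finally show "emeasure (mallows n q) (space (mallows n q)) = 1" .
qed

definition limit_density :: "real \<Rightarrow> real \<Rightarrow> real \<Rightarrow> real" where
  "limit_density \<beta> x y =
     (if \<beta> = 0 then 1
      else (\<beta> / 2) * sinh (\<beta> / 2) /
           (exp (\<beta> / 4) * cosh (\<beta> * (x - y) / 2)
            - exp (- \<beta> / 4) * cosh (\<beta> * (x + y - 1) / 2)) ^ 2)"

end

theory Submission
  imports Defs "HOL-Combinatorics.Multiset_Permutations"
begin

text \<open>The values of a Mallows permutation can be drawn one after the other: given the set of the
  \<open>N\<close> values that remain, the next one is that of rank \<open>k\<close> with probability proportional to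
  \<open>q ^ k\<close>. Hence the number of values \<open>\<le> m\<close> not used in the first \<open>i\<close> draws is a Markov chain
  in \<open>i\<close>, and the first two factorial-type moments of its \<open>1/q\<close>-analogue are explicit products.
  For \<open>q = 1 - \<beta> / n\<close> they show that the variance vanishes in the limit, so that the fraction of
  points \<open>(i / n, \<pi> i / n)\<close> in \<open>[0, s] \<times> [0, t]\<close> converges in probability to a number that turns out
  to be the Frank copula, whose mixed second derivative is \<open>limit_density\<close>. Step functions
  approximate a continuous \<open>f\<close> uniformly, so the probabilities tend to \<open>0\<close> already for
  each fixed \<open>\<epsilon>\<close>.\<close>

section \<open>Moments of the Mallows chain\<close>

text \<open>The coordinate \<open>qint (1 / q) M\<close> straightens the chain, because its
  increment \<open>(1 / q) ^ (M - 1)\<close> turns the weight \<open>qint q M\<close> into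
  \<open>qint (1 / q) M\<close> itself. The square of this coordinate is not an eigenfunction, but
  its product with its value at \<open>M - 1\<close> is, and after division by \<open>n ^ 2\<close>
  the two differ by a term of order \<open>1 / n\<close>. The change of coordinate does no harm in
  the limit: for \<open>q = 1 - \<beta> / n\<close> all powers of \<open>1 / q\<close> up to the
  \<open>n\<close>-th stay between positive constants, so concentration of the transformed count
  forces concentration of the count. The logarithm in the copula comes from inverting the limit of
  the coordinate.\<close>

fun list_inv :: "'a::linorder list \<Rightarrow> nat" where
  "list_inv [] = 0"
| "list_inv (x # xs) = card {y \<in> set xs. y < x} + list_inv xs"

text \<open>The lower bound \<open>k\<close> is free so that induction can run downwards from
  \<open>Suc n\<close>, prepending one position at a time. Injectivity turns a count of later
  positions into a count of later values.\<close>

lemma card_inversions_eq_list_inv: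
  assumes "inj_on \<pi> {k..n}" "k \<le> Suc n"
  shows "card {(i, j). k \<le> i \<and> i < j \<and> j \<le> n \<and> \<pi> i > (\<pi> j :: nat)} = list_inv (map \<pi> [k..<Suc n])"
  using assms(2,1)
proof (induction rule: inc_induct)
  case base
  then show ?case by (auto simp: card_eq_0_iff)
next
  case (step k)
  let ?S = "\<lambda>k. {(i, j). k \<le> i \<and> i < j \<and> j \<le> n \<and> \<pi> i > (\<pi> j :: nat)}"
  let ?J = "{j \<in> {Suc k..n}. \<pi> j < \<pi> k}"
  have fin: "finite (?S (Suc k))"
    by (rule finite_subset[of _ "{..n} \<times> {..n}"]) auto
  have split: "?S k = Pair k ` ?J \<union> ?S (Suc k)"
  proof (intro set_eqI iffI)
    fix p assume "p \<in> ?S k"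
    then show "p \<in> Pair k ` ?J \<union> ?S (Suc k)"
      by (cases p; cases "fst p = k") auto
  qed auto
  have "card (?S k) = card (Pair k ` ?J) + card (?S (Suc k))"
    unfolding split by (intro card_Un_disjoint) (use fin in auto)
  also have "card (Pair k ` ?J) = card ?J"
    by (intro card_image) (auto simp: inj_on_def)
  also have "card ?J = card (\<pi> ` ?J)"
    using step.prems by (intro card_image[symmetric]) (auto simp: inj_on_def)
  also have "\<pi> ` ?J = {y \<in> set (map \<pi> [Suc k..<Suc n]). y < \<pi> k}"
    by auto
  also have "card (?S (Suc k)) = list_inv (map \<pi> [Suc k..<Suc n])"
    by (intro step.IH) (use step.prems in \<open>auto simp: inj_on_def\<close>)
  finally show ?case
    using step.hyps by (simp add: upt_conv_Cons del: upt_Suc)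
qed

lemma inversions_eq_list_inv:
  assumes "\<pi> permutes {1..n}"
  shows "inversions n \<pi> = list_inv (map \<pi> [1..<Suc n])"
  unfolding inversions_def
  by (rule card_inversions_eq_list_inv) (use assms in \<open>auto intro: permutes_inj_on\<close>)

lemma bij_betw_permutes_permutations_of_set:
  "bij_betw (\<lambda>\<pi>. map \<pi> [1..<Suc n]) {\<pi>. \<pi> permutes {1..n}} (permutations_of_set {1..n})"
proof -
  let ?f = "\<lambda>\<pi>. map \<pi> [1..<Suc n]" and ?P = "{\<pi>. \<pi> permutes {1..n}}"
  have inj: "inj_on ?f ?P"
  proof (rule inj_onI)
    fix \<pi> \<sigma> assume *: "\<pi> \<in> ?P" "\<sigma> \<in> ?P" "?f \<pi> = ?f \<sigma>"
    show "\<pi> = \<sigma>"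
    proof
      fix k show "\<pi> k = \<sigma> k"
      proof (cases "k \<in> {1..n}")
        case True
        then have "k \<in> set [1..<Suc n]" by auto
        then show ?thesis using *(3) by (metis map_eq_conv)
      next
        case False
        then show ?thesis using *(1,2) by (metis mem_Collect_eq permutes_not_in)
      qed
    qed
  qed
  have "?f ` ?P \<subseteq> permutations_of_set {1..n}"
  proof (rule image_subsetI)
    fix \<pi> assume "\<pi> \<in> ?P"
    then have *: "\<pi> permutes {1..n}" by simp
    have "set [1..<Suc n] = {1..n}" by auto
    then show "?f \<pi> \<in> permutations_of_set {1..n}"
      using * permutes_image[OF *] permutes_inj_on[OF *]
      by (auto simp: permutations_of_set_def distinct_map simp del: upt_Suc)
  qed
  \<comment> \<open>Surjectivity by counting: both sets have \<open>fact n\<close> elements.\<close>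
  moreover have "card (?f ` ?P) = card (permutations_of_set {1..n})"
    using card_image[OF inj] card_permutations[of "{1..n}" n] by simp
  ultimately have "?f ` ?P = permutations_of_set {1..n}"
    by (intro card_subset_eq) auto
  with inj show ?thesis by (simp add: bij_betw_def)
qed

section \<open>Weighted sums over orderings, and q-integers\<close>

text \<open>An unnormalized expectation. The set \<open>A\<close> is arbitrary because the values
  left after some draws no longer form an interval.\<close>

definition perm_sum :: "real \<Rightarrow> 'a::linorder set \<Rightarrow> ('a list \<Rightarrow> real) \<Rightarrow> real" where
  "perm_sum q A \<phi> = (\<Sum>xs\<in>permutations_of_set A. q ^ list_inv xs * \<phi> xs)"

lemma sum_permutes_eq_perm_sum:
  "(\<Sum>\<pi> | \<pi> permutes {1..n}. q ^ inversions n \<pi> * \<phi> (map \<pi> [1..<Suc n])) = perm_sum q {1..n} \<phi>"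
  unfolding perm_sum_def
  by (subst sum.reindex_bij_betw[OF bij_betw_permutes_permutations_of_set, symmetric])
     (auto intro!: sum.cong simp: inversions_eq_list_inv simp del: upt_Suc)

text \<open>The head \<open>x\<close> forms inversions with exactly the smaller elements of
  \<open>A\<close>, in whatever order they follow, so its weight depends only on its rank and
  factors out.\<close>

lemma perm_sum_rec:
  assumes "finite A" "A \<noteq> {}"
  shows "perm_sum q A \<phi>
       = (\<Sum>x\<in>A. q ^ card {y \<in> A. y < x} * perm_sum q (A - {x}) (\<lambda>xs. \<phi> (x # xs)))"
proof -
  have "perm_sum q A \<phi> = (\<Sum>xs\<in>(\<Union>x\<in>A. (#) x ` permutations_of_set (A - {x})). q ^ list_inv xs * \<phi> xs)"
    using assms by (simp add: perm_sum_def permutations_of_set_nonempty)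
  also have "\<dots> = (\<Sum>x\<in>A. \<Sum>xs\<in>(#) x ` permutations_of_set (A - {x}). q ^ list_inv xs * \<phi> xs)"
    using assms by (intro sum.UNION_disjoint) auto
  also have "\<dots> = (\<Sum>x\<in>A. q ^ card {y \<in> A. y < x} * perm_sum q (A - {x}) (\<lambda>xs. \<phi> (x # xs)))"
  proof (intro sum.cong refl)
    fix x assume "x \<in> A"
    have "(\<Sum>xs\<in>(#) x ` permutations_of_set (A - {x}). q ^ list_inv xs * \<phi> xs)
        = (\<Sum>xs\<in>permutations_of_set (A - {x}). q ^ list_inv (x # xs) * \<phi> (x # xs))"
      by (subst sum.reindex) auto
    also have "\<dots> = (\<Sum>xs\<in>permutations_of_set (A - {x}).
        q ^ card {y \<in> A. y < x} * (q ^ list_inv xs * \<phi> (x # xs)))"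
    proof (intro sum.cong refl)
      fix xs assume "xs \<in> permutations_of_set (A - {x})"
      then have "{y \<in> set xs. y < x} = {y \<in> A. y < x}"
        by (auto simp: permutations_of_set_def)
      then show "q ^ list_inv (x # xs) * \<phi> (x # xs)
          = q ^ card {y \<in> A. y < x} * (q ^ list_inv xs * \<phi> (x # xs))"
        by (simp add: power_add)
    qed
    finally show "(\<Sum>xs\<in>(#) x ` permutations_of_set (A - {x}). q ^ list_inv xs * \<phi> xs)
        = q ^ card {y \<in> A. y < x} * perm_sum q (A - {x}) (\<lambda>xs. \<phi> (x # xs))"
      by (simp add: perm_sum_def sum_distrib_left)
  qed
  finally show ?thesis .
qed

text \<open>The Gaussian q-integer, kept as a sum so that \<open>q = 1\<close> is covered.\<close>

definition qint :: "real \<Rightarrow> nat \<Rightarrow> real" where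
  "qint q k = (\<Sum>j<k. q ^ j)"

lemma qint_0 [simp]: "qint q 0 = 0" and qint_Suc: "qint q (Suc k) = qint q k + q ^ k"
  by (simp_all add: qint_def)

lemma qint_Suc': "qint q (Suc k) = 1 + q * qint q k"
  by (simp add: qint_def sum.lessThan_Suc_shift sum_distrib_left del: sum.lessThan_Suc)

lemma qint_nonneg: "q > 0 \<Longrightarrow> qint q k \<ge> 0"
  by (auto simp: qint_def intro!: sum_nonneg)

lemma qint_pos: "q > 0 \<Longrightarrow> k > 0 \<Longrightarrow> qint q k > 0"
  unfolding qint_def by (intro sum_pos) auto

text \<open>The ranks run through \<open>0, ..., card A - 1\<close>, each taken once.\<close>

lemma sum_power_rank:
  fixes A :: "'a::linorder set"
  assumes "finite A"
  shows "(\<Sum>x\<in>A. q ^ card {y \<in> A. y < x}) = qint q (card A)"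
  using assms
proof (induction A rule: finite_linorder_max_induct)
  case (insert b A)
  have 1: "{y \<in> insert b A. y < b} = A" using insert by auto
  have 2: "{y \<in> insert b A. y < x} = {y \<in> A. y < x}" if "x \<in> A" for x
    using insert that by auto
  have "b \<notin> A" using insert by auto
  then have "(\<Sum>x\<in>insert b A. q ^ card {y \<in> insert b A. y < x})
      = q ^ card A + (\<Sum>x\<in>A. q ^ card {y \<in> insert b A. y < x})"
    using insert 1 by (subst sum.insert) auto
  also have "(\<Sum>x\<in>A. q ^ card {y \<in> insert b A. y < x}) = (\<Sum>x\<in>A. q ^ card {y \<in> A. y < x})"
    by (intro sum.cong refl arg_cong[where f = "\<lambda>S. q ^ card S"] 2)
  finally show ?case
    using insert \<open>b \<notin> A\<close> by (simp add: qint_Suc)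
qed simp

text \<open>The elements up to \<open>m\<close> occupy the lowest ranks, so their ranks in
  \<open>A\<close> are their ranks among themselves.\<close>

lemma sum_power_rank_atMost:
  fixes A :: "'a::linorder set"
  assumes "finite A"
  shows "(\<Sum>x | x \<in> A \<and> x \<le> m. q ^ card {y \<in> A. y < x}) = qint q (card {x \<in> A. x \<le> m})"
proof -
  have "(\<Sum>x | x \<in> A \<and> x \<le> m. q ^ card {y \<in> A. y < x})
      = (\<Sum>x | x \<in> A \<and> x \<le> m. q ^ card {y \<in> {x \<in> A. x \<le> m}. y < x})"
    by (intro sum.cong refl arg_cong[where f = "\<lambda>S. q ^ card S"]) auto
  also have "\<dots> = qint q (card {x \<in> A. x \<le> m})"
    using assms by (intro sum_power_rank) auto
  finally show ?thesis .
qed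

text \<open>Reading a Mallows permutation from left to right, the number \<open>M\<close> of unused values \<open>\<le> m\<close>
  is a Markov chain which, with \<open>N\<close> values left, decreases with probability
  \<open>qint q M / qint q N\<close>; the hypothesis says that \<open>h\<close> is an eigenfunction of each of its steps.\<close>

lemma perm_sum_eigenfunction:
  fixes A :: "'a::linorder set" and q :: real
  assumes eig: "\<And>M N. M \<le> N \<Longrightarrow> 0 < N \<Longrightarrow>
      qint q M * h (M - 1) + (qint q N - qint q M) * h M = lam N * qint q N * h M"
    and "finite A" "i \<le> card A"
  shows "perm_sum q A (\<lambda>xs. h (card {y \<in> set (drop i xs). y \<le> m}))
       = h (card {y \<in> A. y \<le> m}) * (\<Prod>k<i. lam (card A - k)) * (\<Prod>k<card A. qint q (Suc k))"
  using assms(2,3)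
proof (induction i arbitrary: A)
  case 0
  \<comment> \<open>Without any draw \<open>h\<close> factors out and the total weight of all
    orderings remains; it is the q-factorial.\<close>
  have norm: "perm_sum q A (\<lambda>_. 1) = (\<Prod>k<card A. qint q (Suc k))" if "finite A" for A :: "'a set"
    using that
  proof (induction "card A" arbitrary: A)
    case 0
    then show ?case by (simp add: perm_sum_def)
  next
    case (Suc N)
    then have "A \<noteq> {}" by auto
    then have "perm_sum q A (\<lambda>_. 1)
        = (\<Sum>x\<in>A. q ^ card {y \<in> A. y < x} * (\<Prod>k<N. qint q (Suc k)))"
    proof (subst perm_sum_rec)
      have "perm_sum q (A - {x}) (\<lambda>_. 1) = (\<Prod>k<N. qint q (Suc k))" if "x \<in> A" for x
      proof -
        have "N = card (A - {x})" using that Suc by (simp flip: Suc(2))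
        then show ?thesis using Suc(1)[of "A - {x}"] Suc.prems by simp
      qed
      then show "(\<Sum>x\<in>A. q ^ card {y \<in> A. y < x} * perm_sum q (A - {x}) (\<lambda>xs. 1))
          = (\<Sum>x\<in>A. q ^ card {y \<in> A. y < x} * (\<Prod>k<N. qint q (Suc k)))"
        by (intro sum.cong) auto
    qed (use Suc in auto)
    also have "\<dots> = qint q (card A) * (\<Prod>k<N. qint q (Suc k))"
      using Suc by (subst sum_power_rank[symmetric]) (auto simp: sum_distrib_right)
    finally show ?case unfolding Suc(2)[symmetric] by simp
  qed
  have "perm_sum q A (\<lambda>xs. h (card {y \<in> set (drop 0 xs). y \<le> m}))
      = h (card {y \<in> A. y \<le> m}) * perm_sum q A (\<lambda>_. 1)"
    by (auto simp: perm_sum_def sum_distrib_left permutations_of_set_def intro!: sum.cong)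
  then show ?case using norm[OF 0(1)] by simp
next
  case (Suc i)
  define N where "N = card A"
  define M where "M = card {y \<in> A. y \<le> m}"
  define C where "C = (\<Prod>k<i. lam (N - 1 - k)) * (\<Prod>k<N - 1. qint q (Suc k))"
  have "N > 0" using Suc by (auto simp: N_def)
  have "M \<le> N" unfolding M_def N_def using Suc by (intro card_mono) auto
  have step: "perm_sum q (A - {x}) (\<lambda>xs. h (card {y \<in> set (drop (Suc i) (x # xs)). y \<le> m}))
      = h (if x \<le> m then M - 1 else M) * C" if "x \<in> A" for x
  proof -
    have c: "card (A - {x}) = N - 1" using that Suc by (simp add: N_def)
    have "{y \<in> A - {x}. y \<le> m} = {y \<in> A. y \<le> m} - {x}" by auto
    then have "card {y \<in> A - {x}. y \<le> m} = (if x \<le> m then M - 1 else M)"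
      using that Suc by (auto simp: M_def)
    then show ?thesis
      using Suc.IH[of "A - {x}"] Suc.prems c by (simp add: C_def N_def mult.assoc)
  qed
  have "A \<noteq> {}" using Suc by auto
  then have "perm_sum q A (\<lambda>xs. h (card {y \<in> set (drop (Suc i) xs). y \<le> m}))
      = (\<Sum>x\<in>A. q ^ card {y \<in> A. y < x} * (h (if x \<le> m then M - 1 else M) * C))"
    using Suc.prems step by (subst perm_sum_rec) (auto intro!: sum.cong)
  \<comment> \<open>Every draw is counted as if it left \<open>M\<close> unchanged; the draws of
    small values then get the correction \<open>h (M - 1) - h M\<close>. This leaves the two rank
    sums computed above.\<close>
  also have "\<dots> = (\<Sum>x\<in>A. q ^ card {y \<in> A. y < x} * h M * C
      + (if x \<le> m then q ^ card {y \<in> A. y < x} * (h (M - 1) - h M) * C else 0))"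
    by (intro sum.cong) (auto simp: algebra_simps)
  also have "\<dots> = qint q N * h M * C + qint q M * (h (M - 1) - h M) * C"
    using Suc.prems sum_power_rank[of A q] sum_power_rank_atMost[of A q m] unfolding N_def M_def
    by (simp add: sum.distrib sum.If_cases Int_def sum_distrib_right[symmetric])
  also have "\<dots> = (qint q M * h (M - 1) + (qint q N - qint q M) * h M) * C"
    by (simp add: algebra_simps)
  also have "\<dots> = lam N * qint q N * h M * C"
    using eig[OF \<open>M \<le> N\<close> \<open>N > 0\<close>] by simp
  also have "\<dots> = h M * (\<Prod>k<Suc i. lam (N - k)) * (\<Prod>k<N. qint q (Suc k))"
  proof -
    have "(\<Prod>k<N. qint q (Suc k)) = (\<Prod>k<N - 1. qint q (Suc k)) * qint q N"
      using \<open>N > 0\<close> by (cases N) auto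
    moreover have "(\<Prod>k<Suc i. lam (N - k)) = lam N * (\<Prod>k<i. lam (N - 1 - k))"
      by (subst prod.lessThan_Suc_shift) simp
    ultimately show ?thesis by (simp add: C_def)
  qed
  finally show ?case by (simp only: M_def N_def)
qed

section \<open>Expectations under the Mallows measure and the two exact moments\<close>

definition mallows_mean :: "nat \<Rightarrow> real \<Rightarrow> ((nat \<Rightarrow> nat) \<Rightarrow> real) \<Rightarrow> real" where
  "mallows_mean n q \<phi> = (\<Sum>\<pi> | \<pi> permutes {1..n}. q ^ inversions n \<pi> * \<phi> \<pi>) / mallows_norm n q"

lemma mallows_mean_add: "mallows_mean n q (\<lambda>\<pi>. \<phi> \<pi> + \<psi> \<pi>) = mallows_mean n q \<phi> + mallows_mean n q \<psi>"
  by (simp add: mallows_mean_def sum.distrib algebra_simps add_divide_distrib)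

lemma mallows_mean_cmult: "mallows_mean n q (\<lambda>\<pi>. c * \<phi> \<pi>) = c * mallows_mean n q \<phi>"
  by (simp add: mallows_mean_def sum_distrib_left algebra_simps)

lemma mallows_mean_const: "q > 0 \<Longrightarrow> mallows_mean n q (\<lambda>\<pi>. c) = c"
  using mallows_norm_pos[of q n]
  by (simp add: mallows_mean_def mallows_norm_def flip: sum_distrib_right)

lemma mallows_mean_mono:
  assumes "q > 0" "\<And>\<pi>. \<pi> permutes {1..n} \<Longrightarrow> \<phi> \<pi> \<le> \<psi> \<pi>"
  shows "mallows_mean n q \<phi> \<le> mallows_mean n q \<psi>"
  unfolding mallows_mean_def using assms mallows_norm_pos[of q n]
  by (intro divide_right_mono sum_mono mult_left_mono) auto

lemma mallows_chebyshev:
  assumes "q > 0" "\<delta> > 0"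
  shows "measure (mallows n q) {\<pi>. \<pi> permutes {1..n} \<and> \<bar>Y \<pi>\<bar> > \<delta>}
       \<le> mallows_mean n q (\<lambda>\<pi>. (Y \<pi>)\<^sup>2) / \<delta>\<^sup>2"
proof -
  let ?B = "{\<pi>. \<pi> permutes {1..n} \<and> \<bar>Y \<pi>\<bar> > \<delta>}"
  have fin: "finite {\<pi>. \<pi> permutes {1..n}}" by (simp add: finite_permutations)
  have "measure (mallows n q) ?B = (\<Sum>\<pi>\<in>?B. q ^ inversions n \<pi>) / mallows_norm n q"
    using assms by (intro measure_mallows) auto
  also have "\<dots> = mallows_mean n q (\<lambda>\<pi>. if \<bar>Y \<pi>\<bar> > \<delta> then 1 else 0)"
    unfolding mallows_mean_def using fin
    by (auto simp: sum.If_cases if_distrib[of "\<lambda>x. _ * x"] Int_def cong: if_cong)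
  also have "\<dots> \<le> mallows_mean n q (\<lambda>\<pi>. (1 / \<delta>\<^sup>2) * (Y \<pi>)\<^sup>2)"
  proof (intro mallows_mean_mono assms)
    fix \<pi>
    have "\<bar>Y \<pi>\<bar> > \<delta> \<Longrightarrow> \<delta>\<^sup>2 \<le> (Y \<pi>)\<^sup>2"
      using assms by (simp add: abs_le_square_iff[symmetric])
    then show "(if \<bar>Y \<pi>\<bar> > \<delta> then 1 else 0) \<le> (1 / \<delta>\<^sup>2) * (Y \<pi>)\<^sup>2"
      using assms by (auto simp: field_simps)
  qed
  finally show ?thesis by (simp only: mallows_mean_cmult) simp
qed

definition tail_count :: "nat \<Rightarrow> nat \<Rightarrow> nat \<Rightarrow> (nat \<Rightarrow> nat) \<Rightarrow> nat" where
  "tail_count n i m \<pi> = card {j \<in> {i<..n}. \<pi> j \<le> m}"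

lemma mallows_mean_eigenfunction:
  assumes eig: "\<And>M N. M \<le> N \<Longrightarrow> 0 < N \<Longrightarrow>
      qint q M * h (M - 1) + (qint q N - qint q M) * h M = lam N * qint q N * h M"
    and "q > 0" "i \<le> n" "m \<le> n"
  shows "mallows_mean n q (\<lambda>\<pi>. h (tail_count n i m \<pi>)) = h m * (\<Prod>k<i. lam (n - k))"
proof -
  let ?\<phi> = "\<lambda>xs. h (card {y \<in> set (drop i xs). y \<le> m})"
  have "?\<phi> (map \<pi> [1..<Suc n]) = h (tail_count n i m \<pi>)" if "\<pi> permutes {1..n}" for \<pi>
  proof -
    have "{y \<in> set (drop i (map \<pi> [1..<Suc n])). y \<le> m} = \<pi> ` {j \<in> {i<..n}. \<pi> j \<le> m}"
      using \<open>i \<le> n\<close> by (auto simp: drop_map simp del: upt_Suc)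
    moreover have "inj_on \<pi> {j \<in> {i<..n}. \<pi> j \<le> m}"
      using that permutes_inj_on by blast
    ultimately show ?thesis by (simp add: tail_count_def card_image)
  qed
  then have "(\<Sum>\<pi> | \<pi> permutes {1..n}. q ^ inversions n \<pi> * h (tail_count n i m \<pi>))
      = perm_sum q {1..n} ?\<phi>"
    by (subst sum_permutes_eq_perm_sum[symmetric]) (auto intro!: sum.cong simp del: upt_Suc)
  also have "\<dots> = h m * (\<Prod>k<i. lam (n - k)) * (\<Prod>k<n. qint q (Suc k))"
  proof -
    have "{y \<in> {1..n}. y \<le> m} = {1..m}" using \<open>m \<le> n\<close> by auto
    then show ?thesis
      using perm_sum_eigenfunction[OF eig, of "{1..n}" i m] \<open>i \<le> n\<close> by simp
  qed
  moreover have "mallows_norm n q = (\<Prod>k<n. qint q (Suc k))"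
  proof -
    \<comment> \<open>The normalization is the case of the constant eigenfunction with eigenvalue 1
      and no draws.\<close>
    have "mallows_norm n q = perm_sum q {1..n} (\<lambda>_. 1)"
      unfolding sum_permutes_eq_perm_sum[symmetric] by (simp add: mallows_norm_def)
    also have "\<dots> = (\<Prod>k<n. qint q (Suc k))"
      using perm_sum_eigenfunction[of q "\<lambda>_. 1" "\<lambda>_. 1" "{1..n}" 0 0] by (simp add: algebra_simps)
    finally show ?thesis .
  qed
  ultimately have "(\<Sum>\<pi> | \<pi> permutes {1..n}. q ^ inversions n \<pi> * h (tail_count n i m \<pi>))
      = h m * (\<Prod>k<i. lam (n - k)) * mallows_norm n q"
    by (simp only:)
  then show ?thesis
    using mallows_norm_pos[OF \<open>q > 0\<close>, of n] by (simp add: mallows_mean_def)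
qed

text \<open>A geometric sum read backwards. It links the transition weight \<open>qint q\<close> to
  the coordinate \<open>qint (1 / q)\<close>.\<close>

lemma qint_inverse:
  assumes "q > 0"
  shows "qint (1 / q) (Suc k) = qint q (Suc k) * (1 / q) ^ k"
proof (induction k)
  case (Suc k)
  have "(1 / q) ^ k = q * (1 / q) ^ Suc k" using assms by simp
  then have "qint (1 / q) (Suc (Suc k)) = (qint q (Suc k) * q + 1) * (1 / q) ^ Suc k"
    unfolding qint_Suc[of "1 / q" "Suc k"] Suc by (simp only: distrib_right mult.assoc mult_1)
  then show ?case unfolding qint_Suc'[of q "Suc k"] by (simp only: mult.commute add.commute)
qed (simp add: qint_def)

text \<open>The expected loss in one draw is \<open>qint (1 / q) M / qint q N\<close>, so the
  eigenvalue is \<open>1 - 1 / qint q N = q * qint q (N - 1) / qint q N\<close>, and the product of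
  these telescopes.\<close>

lemma mallows_mean_qint:
  assumes "q > 0" "i \<le> n" "m \<le> n" "0 < n"
  shows "mallows_mean n q (\<lambda>\<pi>. qint (1 / q) (tail_count n i m \<pi>))
       = qint (1 / q) m * q ^ i * qint q (n - i) / qint q n"
proof -
  let ?g = "qint (1 / q)"
  have "mallows_mean n q (\<lambda>\<pi>. ?g (tail_count n i m \<pi>))
      = ?g m * (\<Prod>k<i. q * qint q (n - k - 1) / qint q (n - k))"
  proof (rule mallows_mean_eigenfunction)
    fix M N :: nat assume "M \<le> N" "0 < N"
    then obtain N' where N: "N = Suc N'" by (cases N) auto
    have pos: "qint q N > 0" using assms \<open>0 < N\<close> by (intro qint_pos)
    have "qint q M * (?g M - ?g (M - 1)) = ?g M"
    proof (cases M)
      case (Suc K)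
      then have "?g M - ?g (M - 1) = (1 / q) ^ K" by (simp add: qint_Suc[of "1 / q"])
      then show ?thesis using qint_inverse[OF \<open>q > 0\<close>, of K] Suc by simp
    qed simp
    moreover have "qint q N = 1 + q * qint q (N - 1)" by (simp add: N qint_Suc')
    ultimately have "qint q M * ?g (M - 1) + (qint q N - qint q M) * ?g M = q * qint q (N - 1) * ?g M"
      by (simp add: algebra_simps)
    then show "qint q M * ?g (M - 1) + (qint q N - qint q M) * ?g M
        = (q * qint q (N - 1) / qint q N) * qint q N * ?g M"
      using pos by simp
  qed (use assms in auto)
  also have "(\<Prod>k<i. q * qint q (n - k - 1) / qint q (n - k)) = q ^ i * qint q (n - i) / qint q n"
    using \<open>i \<le> n\<close>
  proof (induction i)
    case 0
    then show ?case using qint_pos[OF \<open>q > 0\<close> \<open>0 < n\<close>] by simp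
  next
    case (Suc i)
    then have "qint q (n - i) > 0" using \<open>q > 0\<close> by (intro qint_pos) auto
    then show ?case using Suc by simp
  qed
  finally show ?thesis by simp
qed

text \<open>Here the difference of neighbouring values factors as
  \<open>?g (M - 1) * (?g M - ?g (M - 2))\<close>, whose second factor is
  \<open>(1 + q) * (1 / q) ^ (M - 1)\<close>. The eigenvalue is therefore
  \<open>1 - (1 + q) / qint q N\<close>, and the product telescopes in steps of two.\<close>

lemma mallows_mean_qint2:
  assumes "q > 0" "i \<le> n" "m \<le> n" "2 \<le> n"
  shows "mallows_mean n q (\<lambda>\<pi>. qint (1 / q) (tail_count n i m \<pi>) * qint (1 / q) (tail_count n i m \<pi> - 1))
       = qint (1 / q) m * qint (1 / q) (m - 1) * q ^ (2 * i)
           * (qint q (n - i) * qint q (n - i - 1)) / (qint q n * qint q (n - 1))"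
proof -
  let ?g = "qint (1 / q)"
  let ?h = "\<lambda>M. ?g M * ?g (M - 1)"
  have "mallows_mean n q (\<lambda>\<pi>. ?h (tail_count n i m \<pi>))
      = ?h m * (\<Prod>k<i. q\<^sup>2 * qint q (n - k - 2) / qint q (n - k))"
  proof (rule mallows_mean_eigenfunction)
    fix M N :: nat assume MN: "M \<le> N" "0 < N"
    have pos: "qint q N > 0" using assms MN by (intro qint_pos)
    have *: "qint q M * (?h M - ?h (M - 1)) = (1 + q) * ?h M"
    proof (cases "M \<le> 1")
      case True
      then show ?thesis by (cases M) auto
    next
      case False
      then obtain K where M: "M = Suc (Suc K)"
        by (metis One_nat_def Suc_le_eq not_less_eq_eq old.nat.exhaust zero_less_Suc)
      have "(1 / q) ^ K = q * (1 / q) ^ Suc K" using \<open>q > 0\<close> by simp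
      then have diff: "?g M - ?g K = (1 + q) * (1 / q) ^ Suc K"
        unfolding M qint_Suc[of "1 / q" "Suc K"] qint_Suc[of "1 / q" K]
        by (simp only: distrib_right mult_1)
      have "?h M - ?h (M - 1) = ?g (Suc K) * (?g M - ?g K)"
        by (simp add: M algebra_simps)
      then have "qint q M * (?h M - ?h (M - 1)) = (1 + q) * (qint q M * (1 / q) ^ Suc K * ?g (Suc K))"
        unfolding diff by (simp only: mult_ac)
      also have "qint q M * (1 / q) ^ Suc K = ?g M"
        unfolding M by (rule qint_inverse[OF \<open>q > 0\<close>, symmetric])
      finally show ?thesis by (simp add: M)
    qed
    show "qint q M * ?h (M - 1) + (qint q N - qint q M) * ?h M
        = (q\<^sup>2 * qint q (N - 2) / qint q N) * qint q N * ?h M"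
    \<comment> \<open>For \<open>N = 1\<close> the truncated \<open>N - 2\<close> gives eigenvalue
      0, which is consistent because \<open>?h\<close> vanishes at 0 and at 1.\<close>
    proof (cases "N = 1")
      case True
      then have "M = 0 \<or> M = 1" using MN by auto
      then show ?thesis using True by auto
    next
      case False
      then obtain K where N: "N = Suc (Suc K)" using MN by (metis One_nat_def gr0_implies_Suc neq0_conv)
      then have "qint q N = (1 + q) + q\<^sup>2 * qint q (N - 2)"
        by (simp add: qint_Suc' power2_eq_square algebra_simps)
      with * have "qint q M * ?h (M - 1) + (qint q N - qint q M) * ?h M = q\<^sup>2 * qint q (N - 2) * ?h M"
        by (simp add: algebra_simps)
      then show ?thesis using pos by simp
    qed
  qed (use assms in auto)
  also have "(\<Prod>k<i. q\<^sup>2 * qint q (n - k - 2) / qint q (n - k))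
      = q ^ (2 * i) * (qint q (n - i) * qint q (n - i - 1)) / (qint q n * qint q (n - 1))"
    using \<open>i \<le> n\<close>
  proof (induction i)
    case 0
    then show ?case
      using qint_pos[OF \<open>q > 0\<close>, of n] qint_pos[OF \<open>q > 0\<close>, of "n - 1"] \<open>2 \<le> n\<close> by simp
  next
    case (Suc i)
    then have "qint q (n - i) > 0" using \<open>q > 0\<close> by (intro qint_pos) auto
    moreover have "n - i - 2 = n - Suc i - 1" by simp
    ultimately show ?case using Suc by (simp add: power2_eq_square)
  qed
  finally show ?thesis by simp
qed

section \<open>Concentration as \<open>n\<close> grows\<close>

text \<open>For \<open>x \<ge> 0\<close> this is the integral of \<open>exp (- \<beta> * u)\<close>
  over \<open>u\<close> from 0 to \<open>x\<close>, the limit of the sum \<open>qint\<close> read as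
  a Riemann sum.\<close>

definition qint_lim :: "real \<Rightarrow> real \<Rightarrow> real" where
  "qint_lim \<beta> x = (if \<beta> = 0 then x else (1 - exp (- \<beta> * x)) / \<beta>)"

lemma qint_lim_pos: "x > 0 \<Longrightarrow> qint_lim \<beta> x > 0"
  by (cases "\<beta> > 0") (auto simp: qint_lim_def divide_simps mult_neg_pos)

lemma eventually_mallows_param_pos: "eventually (\<lambda>n. 1 - \<beta> / real n > 0) sequentially"
proof -
  have "(\<lambda>n. 1 - \<beta> / real n) \<longlonglongrightarrow> 1 - 0"
    by (intro tendsto_intros lim_const_over_n)
  then show ?thesis by (intro order_tendstoD(1)[where y = 1]) auto
qed

text \<open>Taking the logarithm of the \<open>n\<close>-th power separates the classical limit
  \<open>exp (- \<beta>)\<close> from the ratio \<open>k n / n\<close>.\<close>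

lemma tendsto_mallows_param_power:
  assumes "(\<lambda>n. real (k n) / real n) \<longlonglongrightarrow> x"
  shows "(\<lambda>n. (1 - \<beta> / real n) ^ k n) \<longlonglongrightarrow> exp (- \<beta> * x)"
proof -
  have "(\<lambda>n. ln ((1 + (- \<beta>) / real n) ^ n)) \<longlonglongrightarrow> ln (exp (- \<beta>))"
    by (intro tendsto_ln tendsto_exp_limit_sequentially) auto
  then have "(\<lambda>n. exp (ln ((1 - \<beta> / real n) ^ n) * (real (k n) / real n))) \<longlonglongrightarrow> exp (- \<beta> * x)"
    using assms by (intro tendsto_intros) auto
  moreover have "eventually (\<lambda>n. exp (ln ((1 - \<beta> / real n) ^ n) * (real (k n) / real n))
      = (1 - \<beta> / real n) ^ k n) sequentially"
    using eventually_mallows_param_pos[of \<beta>] eventually_gt_at_top[of 0]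
  proof eventually_elim
    case (elim n)
    then have "ln ((1 - \<beta> / real n) ^ n) * (real (k n) / real n) = real (k n) * ln (1 - \<beta> / real n)"
      by (simp add: ln_realpow)
    then show ?case using elim by (simp add: exp_of_nat_mult)
  qed
  ultimately show ?thesis by (rule Lim_transform_eventually)
qed

lemma qint_eq: "q \<noteq> 1 \<Longrightarrow> qint q k = (1 - q ^ k) / (1 - q)"
  by (simp add: qint_def sum_gp_strict)

lemma tendsto_qint:
  assumes "(\<lambda>n. real (k n) / real n) \<longlonglongrightarrow> x"
  shows "(\<lambda>n. qint (1 - \<beta> / real n) (k n) / real n) \<longlonglongrightarrow> qint_lim \<beta> x"
proof (cases "\<beta> = 0")
  case True
  then show ?thesis using assms by (simp add: qint_def qint_lim_def)
next
  case False
  have "(\<lambda>n. (1 - (1 - \<beta> / real n) ^ k n) / \<beta>) \<longlonglongrightarrow> qint_lim \<beta> x"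
    using False unfolding qint_lim_def
    by (auto intro!: tendsto_intros tendsto_mallows_param_power[OF assms, simplified])
  moreover have "eventually (\<lambda>n. (1 - (1 - \<beta> / real n) ^ k n) / \<beta>
      = qint (1 - \<beta> / real n) (k n) / real n) sequentially"
    using eventually_gt_at_top[of 0]
    by eventually_elim (use False in \<open>auto simp: qint_eq\<close>)
  ultimately show ?thesis by (rule Lim_transform_eventually)
qed

text \<open>The base \<open>1 / (1 - \<beta> / n)\<close> is not \<open>1 + \<beta> / n\<close>, so
  the preceding limit at \<open>- \<beta>\<close> does not apply directly. The closed form carries
  an extra factor \<open>1 - \<beta> / n\<close>, which tends to 1.\<close>

lemma tendsto_qint_inverse:
  assumes "(\<lambda>n. real (k n) / real n) \<longlonglongrightarrow> x"
  shows "(\<lambda>n. qint (1 / (1 - \<beta> / real n)) (k n) / real n) \<longlonglongrightarrow> qint_lim (- \<beta>) x"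
proof (cases "\<beta> = 0")
  case True
  then show ?thesis using assms by (simp add: qint_def qint_lim_def)
next
  case False
  have "(\<lambda>n. (1 - \<beta> / real n) * (1 / (1 - \<beta> / real n) ^ k n - 1) / \<beta>)
      \<longlonglongrightarrow> (1 - 0) * (1 / exp (- \<beta> * x) - 1) / \<beta>"
    using False
    by (intro tendsto_intros tendsto_mallows_param_power[OF assms] lim_const_over_n) auto
  also have "(1 - 0) * (1 / exp (- \<beta> * x) - 1) / \<beta> = qint_lim (- \<beta>) x"
    using False by (simp add: qint_lim_def exp_minus field_simps)
  finally have "(\<lambda>n. (1 - \<beta> / real n) * (1 / (1 - \<beta> / real n) ^ k n - 1) / \<beta>)
      \<longlonglongrightarrow> qint_lim (- \<beta>) x" .
  moreover have "eventually (\<lambda>n. (1 - \<beta> / real n) * (1 / (1 - \<beta> / real n) ^ k n - 1) / \<beta>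
      = qint (1 / (1 - \<beta> / real n)) (k n) / real n) sequentially"
    using eventually_gt_at_top[of 0] eventually_mallows_param_pos[of \<beta>]
  proof eventually_elim
    case (elim n)
    define q where "q = 1 - \<beta> / real n"
    define d where "d = 1 - q"
    define w where "w = 1 / q ^ k n"
    have q: "q > 0" "d \<noteq> 0" "\<beta> = real n * d" using elim False by (auto simp: q_def d_def)
    then have "1 - 1 / q = - d / q" "1 / q \<noteq> 1" by (auto simp: d_def field_simps)
    then have "qint (1 / q) (k n) = (1 - w) / (- d / q)" by (simp add: qint_eq w_def power_divide)
    moreover have "q * (w - 1) / \<beta> = (1 - w) / (- d / q) / real n"
      using elim q by (simp add: divide_simps) (simp add: algebra_simps)
    ultimately have "q * (w - 1) / \<beta> = qint (1 / q) (k n) / real n"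
      by simp
    then have "q * (1 / q ^ k n - 1) / \<beta> = qint (1 / q) (k n) / real n"
      by (simp only: w_def)
    then show ?case by (simp only: q_def)
  qed
  ultimately show ?thesis by (rule Lim_transform_eventually)
qed

section \<open>Uniform estimates and rounding\<close>

text \<open>Powers are monotone in the exponent, in a direction that depends on \<open>r\<close>, so
  control of the \<open>n\<close>-th power controls all earlier ones.\<close>

lemma power_between:
  fixes r :: real
  assumes "r > 0" "k \<le> n"
  shows "min 1 (r ^ n) \<le> r ^ k" "r ^ k \<le> max 1 (r ^ n)"
proof -
  consider "r \<ge> 1" | "r \<le> 1" by linarith
  then have "min 1 (r ^ n) \<le> r ^ k \<and> r ^ k \<le> max 1 (r ^ n)"
  proof cases
    case 1
    then show ?thesis using assms power_increasing[of k n r] one_le_power[of r k]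
      by (auto simp: min_le_iff_disj le_max_iff_disj)
  next
    case 2
    then show ?thesis using assms power_decreasing[of k n r] power_le_one[of r k]
      by (auto simp: min_le_iff_disj le_max_iff_disj)
  qed
  then show "min 1 (r ^ n) \<le> r ^ k" "r ^ k \<le> max 1 (r ^ n)" by auto
qed

text \<open>Each unit step of \<open>qint r\<close> is some \<open>r ^ j\<close>, hence at least
  \<open>c\<close>. This is the bound that carries a deviation of the count over to its
  transform.\<close>

lemma qint_diff_ge:
  assumes "\<And>j. j < n \<Longrightarrow> c \<le> r ^ j" "a \<le> n" "b \<le> n" "0 \<le> c"
  shows "c * \<bar>real a - real b\<bar> \<le> \<bar>qint r a - qint r b\<bar>"
proof -
  have *: "c * (real b - real a) \<le> qint r b - qint r a" if "a \<le> b" "b \<le> n" for a b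
    using that
  proof (induction b rule: dec_induct)
    case (step b)
    then show ?case using assms(1)[of b] by (simp add: qint_Suc algebra_simps)
  qed simp
  have "0 \<le> c * \<bar>real a - real b\<bar>" using assms by simp
  then show ?thesis using *[of a b] *[of b a] assms
    by (cases "a \<le> b") (auto simp: abs_if algebra_simps)
qed

lemma measure_mallows_mono:
  assumes "q > 0" "A \<subseteq> B" "B \<subseteq> {\<pi>. \<pi> permutes {1..n}}"
  shows "measure (mallows n q) A \<le> measure (mallows n q) B"
proof -
  interpret prob_space "mallows n q" by (rule prob_space_mallows[OF assms(1)])
  show ?thesis using assms by (intro finite_measure_mono) auto
qed

lemma tail_count_le: "tail_count n i m \<pi> \<le> n"
proof -
  have "tail_count n i m \<pi> \<le> card {i<..n}" unfolding tail_count_def by (intro card_mono) auto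
  then show ?thesis by simp
qed

lemma tendsto_nat_floor_div:
  assumes "x \<ge> 0"
  shows "(\<lambda>n. real (nat \<lfloor>real n * x\<rfloor>) / real n) \<longlonglongrightarrow> x"
proof (rule tendsto_sandwich)
  have fl: "real n * x - 1 \<le> real (nat \<lfloor>real n * x\<rfloor>)" "real (nat \<lfloor>real n * x\<rfloor>) \<le> real n * x" for n
  proof -
    have "real_of_int \<lfloor>real n * x\<rfloor> = real (nat \<lfloor>real n * x\<rfloor>)" using assms by simp
    then show "real n * x - 1 \<le> real (nat \<lfloor>real n * x\<rfloor>)" "real (nat \<lfloor>real n * x\<rfloor>) \<le> real n * x"
      by linarith+
  qed
  show "eventually (\<lambda>n. x - 1 / real n \<le> real (nat \<lfloor>real n * x\<rfloor>) / real n) sequentially"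
    using eventually_gt_at_top[of 0]
  proof eventually_elim
    case (elim n)
    then have "x - 1 / real n = (real n * x - 1) / real n" by (simp add: field_simps)
    also have "\<dots> \<le> real (nat \<lfloor>real n * x\<rfloor>) / real n" by (intro divide_right_mono fl) auto
    finally show ?case .
  qed
  show "eventually (\<lambda>n. real (nat \<lfloor>real n * x\<rfloor>) / real n \<le> x) sequentially"
    using eventually_gt_at_top[of 0] by eventually_elim (use fl in \<open>simp add: field_simps\<close>)
  have "(\<lambda>n. x - 1 / real n) \<longlonglongrightarrow> x - 0" by (intro tendsto_intros lim_const_over_n)
  then show "(\<lambda>n. x - 1 / real n) \<longlonglongrightarrow> x" by simp
qed simp

lemma tendsto_pred_div:
  assumes "(\<lambda>n. real (k n) / real n) \<longlonglongrightarrow> x"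
  shows "(\<lambda>n. real (k n - 1) / real n) \<longlonglongrightarrow> x"
proof (rule tendsto_sandwich)
  show "eventually (\<lambda>n. real (k n) / real n - 1 / real n \<le> real (k n - 1) / real n) sequentially"
    by (intro always_eventually allI) (auto simp flip: diff_divide_distrib intro!: divide_right_mono)
  show "eventually (\<lambda>n. real (k n - 1) / real n \<le> real (k n) / real n) sequentially"
    by (intro always_eventually allI divide_right_mono) auto
  have "(\<lambda>n. real (k n) / real n - 1 / real n) \<longlonglongrightarrow> x - 0"
    by (intro tendsto_intros assms lim_const_over_n)
  then show "(\<lambda>n. real (k n) / real n - 1 / real n) \<longlonglongrightarrow> x" by simp
qed (rule assms)

text \<open>Chebyshev is applied to the transformed count, whose moments are explicit; a deviation
  of the count itself forces one of the transform by \<open>qint_diff_ge\<close>. The equation for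
  \<open>\<mu>\<close> says that its transform is the limit of the exact mean.\<close>

lemma tail_count_concentration:
  fixes \<beta> x y \<mu> :: real and i m :: "nat \<Rightarrow> nat"
  assumes im: "\<And>n. i n \<le> n" "\<And>n. m n \<le> n"
    and lim: "(\<lambda>n. real (i n) / real n) \<longlonglongrightarrow> x" "(\<lambda>n. real (m n) / real n) \<longlonglongrightarrow> y"
    and \<mu>: "0 \<le> \<mu>" "\<mu> \<le> 1"
      "qint_lim (- \<beta>) \<mu> = qint_lim (- \<beta>) y * exp (- \<beta> * x) * qint_lim \<beta> (1 - x) / qint_lim \<beta> 1"
    and "\<epsilon> > 0"
  shows "(\<lambda>n. measure (mallows n (1 - \<beta> / real n))
      {\<pi>. \<pi> permutes {1..n} \<and> \<bar>real (tail_count n (i n) (m n) \<pi>) / real n - \<mu>\<bar> > \<epsilon>}) \<longlonglongrightarrow> 0"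
proof -
  define q where "q = (\<lambda>n::nat. 1 - \<beta> / real n)"
  define g where "g = (\<lambda>n. qint (1 / q n))"
  define T where "T = (\<lambda>n \<pi>. tail_count n (i n) (m n) \<pi>)"
  \<comment> \<open>The transform exists only at integers, so the centre is
    \<open>\<gamma> n\<close>, its value at the rounded \<open>n * \<mu>\<close>, rather than the
    limit \<open>G\<close>. The rounding costs half of \<open>\<epsilon>\<close>.\<close>
  define k where "k = (\<lambda>n. nat \<lfloor>real n * \<mu>\<rfloor>)"
  define \<gamma> where "\<gamma> = (\<lambda>n. g n (k n) / real n)"
  define G where "G = qint_lim (- \<beta>) \<mu>"
  \<comment> \<open>The powers \<open>(1 / q n) ^ j\<close> with \<open>j \<le> n\<close> lie
    between 1 and a number tending to \<open>exp \<beta>\<close>; the factors 2 leave room before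
    the limit is reached.\<close>
  define c where "c = min 1 (exp \<beta> / 2)"
  define C where "C = max 1 (2 * exp \<beta>)"
  define E1 where "E1 = (\<lambda>n. mallows_mean n (q n) (\<lambda>\<pi>. g n (T n \<pi>)) / real n)"
  define E2 where "E2 = (\<lambda>n. mallows_mean n (q n) (\<lambda>\<pi>. g n (T n \<pi>) * g n (T n \<pi> - 1)) / (real n)\<^sup>2)"
  \<comment> \<open>An upper bound for the mean square of the transformed count divided by
    \<open>n\<close>, centred at \<open>\<gamma> n\<close>. The term with \<open>C\<close> pays for
    replacing the square by the product of neighbouring values.\<close>
  define U where "U = (\<lambda>n. E2 n + C / real n * E1 n - 2 * \<gamma> n * E1 n + (\<gamma> n)\<^sup>2)"
  have c: "c > 0" by (simp add: c_def)
  have kn: "k n \<le> n" for n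
  proof -
    have "real n * \<mu> \<le> real n" using \<mu> by (simp add: mult_left_le)
    then show ?thesis unfolding k_def by linarith
  qed
  have k_lim: "(\<lambda>n. real (k n) / real n) \<longlonglongrightarrow> \<mu>"
    unfolding k_def by (intro tendsto_nat_floor_div \<mu>)
  have \<gamma>_lim: "\<gamma> \<longlonglongrightarrow> G"
    unfolding \<gamma>_def g_def q_def G_def by (rule tendsto_qint_inverse[OF k_lim])
  have one_lim: "(\<lambda>n. real n / real n) \<longlonglongrightarrow> 1"
    by (rule Lim_transform_eventually[OF tendsto_const])
       (use eventually_gt_at_top[of 0] in \<open>auto elim!: eventually_mono\<close>)
  have ni_lim: "(\<lambda>n. real (n - i n) / real n) \<longlonglongrightarrow> 1 - x"
    using tendsto_diff[OF one_lim lim(1)] im by (simp add: of_nat_diff diff_divide_distrib)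
  note [tendsto_intros] = tendsto_qint_inverse[OF lim(2)] tendsto_mallows_param_power[OF lim(1)]
    tendsto_qint[OF ni_lim] tendsto_qint[OF one_lim] tendsto_qint_inverse[OF tendsto_pred_div[OF lim(2)]]
    tendsto_qint[OF tendsto_pred_div[OF ni_lim]] tendsto_qint[OF tendsto_pred_div[OF one_lim]]
  have B1: "qint_lim \<beta> 1 > 0" by (rule qint_lim_pos) simp
  have ev: "eventually (\<lambda>n. 2 \<le> n \<and> q n > 0) sequentially"
    using eventually_ge_at_top[of 2] eventually_mallows_param_pos[of \<beta>]
    unfolding q_def by eventually_elim auto

  have E1_lim: "E1 \<longlonglongrightarrow> G"
  proof (rule Lim_transform_eventually)
    show "(\<lambda>n. (g n (m n) / real n) * q n ^ i n * (qint (q n) (n - i n) / real n) / (qint (q n) n / real n))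
        \<longlonglongrightarrow> G"
      using B1 unfolding g_def q_def G_def \<mu>(3) by (intro tendsto_intros) auto
    show "eventually (\<lambda>n. (g n (m n) / real n) * q n ^ i n * (qint (q n) (n - i n) / real n)
        / (qint (q n) n / real n) = E1 n) sequentially"
      using ev
    proof eventually_elim
      case (elim n)
      then show ?case
        unfolding E1_def T_def g_def using im by (subst mallows_mean_qint) auto
    qed
  qed
  have E2_lim: "E2 \<longlonglongrightarrow> G\<^sup>2"
  proof (rule Lim_transform_eventually)
    have "(\<lambda>n. (g n (m n) / real n) * (g n (m n - 1) / real n) * (q n ^ i n)\<^sup>2
          * ((qint (q n) (n - i n) / real n) * (qint (q n) (n - i n - 1) / real n))
          / ((qint (q n) n / real n) * (qint (q n) (n - 1) / real n)))
        \<longlonglongrightarrow> qint_lim (- \<beta>) y * qint_lim (- \<beta>) y * (exp (- \<beta> * x))\<^sup>2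
          * (qint_lim \<beta> (1 - x) * qint_lim \<beta> (1 - x)) / (qint_lim \<beta> 1 * qint_lim \<beta> 1)"
      using B1 unfolding g_def q_def by (intro tendsto_intros) auto
    also have "qint_lim (- \<beta>) y * qint_lim (- \<beta>) y * (exp (- \<beta> * x))\<^sup>2
          * (qint_lim \<beta> (1 - x) * qint_lim \<beta> (1 - x)) / (qint_lim \<beta> 1 * qint_lim \<beta> 1) = G\<^sup>2"
      unfolding G_def \<mu>(3) by (simp add: power2_eq_square)
    finally show "(\<lambda>n. (g n (m n) / real n) * (g n (m n - 1) / real n) * (q n ^ i n)\<^sup>2
          * ((qint (q n) (n - i n) / real n) * (qint (q n) (n - i n - 1) / real n))
          / ((qint (q n) n / real n) * (qint (q n) (n - 1) / real n))) \<longlonglongrightarrow> G\<^sup>2" .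
    show "eventually (\<lambda>n. (g n (m n) / real n) * (g n (m n - 1) / real n) * (q n ^ i n)\<^sup>2
          * ((qint (q n) (n - i n) / real n) * (qint (q n) (n - i n - 1) / real n))
          / ((qint (q n) n / real n) * (qint (q n) (n - 1) / real n)) = E2 n) sequentially"
      using ev
    proof eventually_elim
      case (elim n)
      have "E2 n = qint (1 / q n) (m n) * qint (1 / q n) (m n - 1) * q n ^ (2 * i n)
           * (qint (q n) (n - i n) * qint (q n) (n - i n - 1)) / (qint (q n) n * qint (q n) (n - 1))
           / (real n)\<^sup>2"
        unfolding E2_def T_def g_def using im elim by (subst mallows_mean_qint2) auto
      then show ?case
        using elim by (simp add: g_def power2_eq_square power_mult power_mult_distrib)
    qed
  qed
  \<comment> \<open>The variance vanishes because the limit of the product moment is the square of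
    the limit of the mean.\<close>
  have "U \<longlonglongrightarrow> G\<^sup>2 + 0 * G - 2 * G * G + G\<^sup>2"
    unfolding U_def by (intro tendsto_intros E1_lim E2_lim \<gamma>_lim lim_const_over_n)
  then have U_lim: "U \<longlonglongrightarrow> 0" by (simp add: power2_eq_square)

  have pow: "(\<lambda>n. (1 / q n) ^ n) \<longlonglongrightarrow> exp \<beta>"
    using tendsto_divide[OF tendsto_const[of 1] tendsto_mallows_param_power[OF one_lim, of \<beta>]]
    by (simp add: q_def power_divide exp_minus inverse_eq_divide)
  have "exp \<beta> / 2 < exp \<beta>" "exp \<beta> < 2 * exp \<beta>" by simp_all
  note pow_ev = order_tendstoD(1)[OF pow this(1)] order_tendstoD(2)[OF pow this(2)]
  have bounds: "eventually (\<lambda>n. \<forall>j\<le>n. c \<le> (1 / q n) ^ j \<and> (1 / q n) ^ j \<le> C) sequentially"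
    using pow_ev ev
  proof eventually_elim
    case (elim n)
    then have q: "1 / q n > 0" by simp
    show ?case
    proof (intro allI impI)
      fix j assume j: "j \<le> n"
      show "c \<le> (1 / q n) ^ j \<and> (1 / q n) ^ j \<le> C"
        using power_between[OF q j] elim unfolding c_def C_def by (auto simp: min_def max_def split: if_splits)
    qed
  qed

  have "\<mu> - \<epsilon> / 2 < \<mu>" "\<mu> < \<mu> + \<epsilon> / 2" using \<open>\<epsilon> > 0\<close> by simp_all
  note k_ev = order_tendstoD(1)[OF k_lim this(1)] order_tendstoD(2)[OF k_lim this(2)]
  have main: "eventually (\<lambda>n. measure (mallows n (q n))
      {\<pi>. \<pi> permutes {1..n} \<and> \<bar>real (T n \<pi>) / real n - \<mu>\<bar> > \<epsilon>} \<le> U n / (c * \<epsilon> / 2)\<^sup>2) sequentially"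
    using ev bounds k_ev
  proof eventually_elim
    case (elim n)
    then have n: "0 < n" and q: "q n > 0" by auto
    have k: "\<bar>real (k n) / real n - \<mu>\<bar> < \<epsilon> / 2" unfolding abs_less_iff using elim by linarith
    define Z where "Z = (\<lambda>\<pi>. g n (T n \<pi>) / real n - \<gamma> n)"
    have Tn: "T n \<pi> \<le> n" for \<pi> by (simp add: T_def tail_count_le)
    have sub: "{\<pi>. \<pi> permutes {1..n} \<and> \<bar>real (T n \<pi>) / real n - \<mu>\<bar> > \<epsilon>}
        \<subseteq> {\<pi>. \<pi> permutes {1..n} \<and> \<bar>Z \<pi>\<bar> > c * \<epsilon> / 2}"
    proof safe
      fix \<pi> assume "\<epsilon> < \<bar>real (T n \<pi>) / real n - \<mu>\<bar>"
      then have "\<epsilon> / 2 < \<bar>real (T n \<pi>) / real n - real (k n) / real n\<bar>" using k by linarith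
      then have "c * \<epsilon> / 2 < c * \<bar>real (T n \<pi>) / real n - real (k n) / real n\<bar>" using c by simp
      also have "\<dots> = c * \<bar>real (T n \<pi>) - real (k n)\<bar> / real n"
        by (simp flip: diff_divide_distrib)
      also have "\<dots> \<le> \<bar>g n (T n \<pi>) - g n (k n)\<bar> / real n"
        unfolding g_def using elim c Tn kn by (intro divide_right_mono qint_diff_ge[of n]) auto
      also have "\<dots> = \<bar>Z \<pi>\<bar>" by (simp add: Z_def \<gamma>_def flip: diff_divide_distrib)
      finally show "c * \<epsilon> / 2 < \<bar>Z \<pi>\<bar>" .
    qed
    have "measure (mallows n (q n)) {\<pi>. \<pi> permutes {1..n} \<and> \<bar>real (T n \<pi>) / real n - \<mu>\<bar> > \<epsilon>}
        \<le> measure (mallows n (q n)) {\<pi>. \<pi> permutes {1..n} \<and> \<bar>Z \<pi>\<bar> > c * \<epsilon> / 2}"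
      by (intro measure_mallows_mono q sub) auto
    also have "\<dots> \<le> mallows_mean n (q n) (\<lambda>\<pi>. (Z \<pi>)\<^sup>2) / (c * \<epsilon> / 2)\<^sup>2"
      using c \<open>\<epsilon> > 0\<close> by (intro mallows_chebyshev q) auto
    also have "mallows_mean n (q n) (\<lambda>\<pi>. (Z \<pi>)\<^sup>2) \<le> mallows_mean n (q n) (\<lambda>\<pi>.
        (1 / (real n)\<^sup>2 * (g n (T n \<pi>) * g n (T n \<pi> - 1))
        + (C / (real n)\<^sup>2 - 2 * \<gamma> n / real n) * g n (T n \<pi>)) + (\<gamma> n)\<^sup>2)"
    proof (intro mallows_mean_mono q)
      fix \<pi>
      define t where "t = T n \<pi>"
      have g0: "g n t \<ge> 0" unfolding g_def using q by (intro qint_nonneg) auto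
      \<comment> \<open>The increment is a power of \<open>1 / q n\<close> with exponent below
        \<open>n\<close>; at \<open>t = 0\<close> the truncated \<open>t - 1\<close> makes it 0.
        This trades the square of \<open>g n t\<close> for the product whose mean is known.\<close>
      have "g n t - g n (t - 1) \<le> C"
      proof (cases t)
        case 0
        then show ?thesis by (simp add: C_def g_def le_max_iff_disj)
      next
        case (Suc s)
        then show ?thesis using elim Tn[of \<pi>] by (auto simp: g_def qint_Suc t_def)
      qed
      then have "g n t * (g n t - g n (t - 1)) \<le> g n t * C" using g0 by (rule mult_left_mono)
      then have "(g n t)\<^sup>2 / (real n)\<^sup>2 \<le> (g n t * g n (t - 1) + C * g n t) / (real n)\<^sup>2"
        by (intro divide_right_mono) (auto simp: power2_eq_square algebra_simps)
      then show "(Z \<pi>)\<^sup>2 \<le> (1 / (real n)\<^sup>2 * (g n (T n \<pi>) * g n (T n \<pi> - 1))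
          + (C / (real n)\<^sup>2 - 2 * \<gamma> n / real n) * g n (T n \<pi>)) + (\<gamma> n)\<^sup>2"
        unfolding Z_def t_def[symmetric]
        by (simp add: power2_diff power_divide add_divide_distrib algebra_simps)
    qed
    also have "\<dots> = U n"
      using q unfolding mallows_mean_add mallows_mean_cmult mallows_mean_const[OF q] U_def E1_def E2_def
      by (simp add: power2_eq_square algebra_simps)
    finally show ?case by (simp add: divide_right_mono)
  qed
  have "(\<lambda>n. U n / (c * \<epsilon> / 2)\<^sup>2) \<longlonglongrightarrow> 0 / (c * \<epsilon> / 2)\<^sup>2"
    using c \<open>\<epsilon> > 0\<close> by (intro tendsto_intros U_lim) auto
  then have "(\<lambda>n. U n / (c * \<epsilon> / 2)\<^sup>2) \<longlonglongrightarrow> 0" by simp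
  then have "(\<lambda>n. measure (mallows n (q n))
      {\<pi>. \<pi> permutes {1..n} \<and> \<bar>real (T n \<pi>) / real n - \<mu>\<bar> > \<epsilon>}) \<longlonglongrightarrow> 0"
    by (intro tendsto_sandwich[OF _ main tendsto_const]) auto
  then show ?thesis by (simp only: q_def T_def)
qed

section \<open>The Frank copula\<close>

text \<open>The usual Frank family with parameter \<open>\<beta>\<close>; at 0 it is the
  independence copula.\<close>

definition frank_copula :: "real \<Rightarrow> real \<Rightarrow> real \<Rightarrow> real" where
  "frank_copula \<beta> x y = (if \<beta> = 0 then x * y
     else - ln (1 - (1 - exp (- \<beta> * x)) * (1 - exp (- \<beta> * y)) / (1 - exp (- \<beta>))) / \<beta>)"

text \<open>The expression is the convex combination
  \<open>(1 - t) + t * exp (- \<beta> * y)\<close> of two positive numbers, whatever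
  \<open>y\<close> is.\<close>

lemma frank_arg_pos:
  fixes \<beta> x y :: real
  assumes "\<beta> \<noteq> 0" "x \<in> {0..1}"
  shows "1 - (1 - exp (- \<beta> * x)) * (1 - exp (- \<beta> * y)) / (1 - exp (- \<beta>)) > 0"
proof -
  define t where "t = (1 - exp (- \<beta> * x)) / (1 - exp (- \<beta>))"
  have "0 \<le> t \<and> t \<le> 1"
  proof (cases "\<beta> > 0")
    case True
    then have "\<beta> * x \<le> \<beta>" using mult_left_le[of x \<beta>] assms by auto
    then show ?thesis using True assms by (auto simp: t_def divide_simps)
  next
    case False
    then have *: "\<beta> < 0" using assms by simp
    then have "\<beta> \<le> \<beta> * x" using mult_left_le[of x "- \<beta>"] assms by auto
    moreover have "\<beta> * x \<le> 0" using * assms by (simp add: mult_nonpos_nonneg)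
    ultimately show ?thesis using * by (auto simp: t_def divide_simps)
  qed
  moreover have "1 - (1 - exp (- \<beta> * x)) * (1 - exp (- \<beta> * y)) / (1 - exp (- \<beta>))
      = (1 - t) + t * exp (- \<beta> * y)"
  proof -
    have "(1 - exp (- \<beta> * x)) * (1 - exp (- \<beta> * y)) / (1 - exp (- \<beta>)) = t * (1 - exp (- \<beta> * y))"
      by (simp add: t_def)
    then show ?thesis by (simp only: right_diff_distrib)
  qed
  moreover have "(1 - t) + t * exp (- \<beta> * y) > 0" if "0 \<le> t" "t \<le> 1"
  proof (cases "t = 0")
    case False
    then have "t * exp (- \<beta> * y) > 0" using that by simp
    then show ?thesis using that by linarith
  qed simp
  ultimately show ?thesis by simp
qed

section \<open>The density as mixed derivative of the copula\<close>

definition frank_denom :: "real \<Rightarrow> real \<Rightarrow> real \<Rightarrow> real" where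
  "frank_denom \<beta> x y = (1 - exp (- \<beta>)) - (1 - exp (- \<beta> * x)) * (1 - exp (- \<beta> * y))"

lemma frank_denom_eq:
  assumes "\<beta> \<noteq> 0"
  shows "frank_denom \<beta> x y
    = (1 - exp (- \<beta>)) * (1 - (1 - exp (- \<beta> * x)) * (1 - exp (- \<beta> * y)) / (1 - exp (- \<beta>)))"
  using assms by (simp add: frank_denom_def field_simps)

lemma frank_denom_nonzero:
  assumes "\<beta> \<noteq> 0" "x \<in> {0..1}"
  shows "frank_denom \<beta> x y \<noteq> 0"
proof -
  have "1 - exp (- \<beta>) \<noteq> 0" using assms by simp
  then show ?thesis
    using frank_arg_pos[OF assms, of y] unfolding frank_denom_eq[OF assms(1)]
    by (metis less_irrefl mult_eq_0_iff)
qed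

text \<open>This form is rational in \<open>exp (- \<beta> * x)\<close> and
  \<open>exp (- \<beta> * y)\<close>, so that elementary antiderivatives are visible.\<close>

lemma limit_density_eq:
  assumes "\<beta> \<noteq> 0"
  shows "limit_density \<beta> x y
    = \<beta> * (1 - exp (- \<beta>)) * exp (- \<beta> * x) * exp (- \<beta> * y) / (frank_denom \<beta> x y)\<^sup>2"
proof -
  \<comment> \<open>Half and quarter exponents make every exponential involved a monomial in
    \<open>X\<close>, \<open>Y\<close>, \<open>B\<close> and their inverses. \<open>K\<close> is the
    factor between the hyperbolic base of the square and \<open>frank_denom\<close>; its square
    cancels between numerator and denominator.\<close>
  define X where "X = exp (\<beta> * x / 2)"
  define Y where "Y = exp (\<beta> * y / 2)"
  define B where "B = exp (\<beta> / 4)"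
  define K where "K = X * Y * B / 2"
  have pos: "X > 0" "Y > 0" "B > 0" "K > 0" by (simp_all add: X_def Y_def B_def K_def)
  have e: "exp (- \<beta> * x) = 1 / X\<^sup>2" "exp (- \<beta> * y) = 1 / Y\<^sup>2" "exp (- \<beta>) = 1 / B ^ 4"
    "exp (- \<beta> / 4) = 1 / B" "exp (\<beta> / 2) = B\<^sup>2" "exp (- (\<beta> / 2)) = 1 / B\<^sup>2"
    "exp (\<beta> * (x - y) / 2) = X / Y" "exp (- (\<beta> * (x - y) / 2)) = Y / X"
    "exp (\<beta> * (x + y - 1) / 2) = X * Y / B\<^sup>2" "exp (- (\<beta> * (x + y - 1) / 2)) = B\<^sup>2 / (X * Y)"
    by (simp_all add: X_def Y_def B_def field_simps exp_minus flip: exp_of_nat_mult exp_add exp_diff)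
  have D: "exp (\<beta> / 4) * cosh (\<beta> * (x - y) / 2) - exp (- \<beta> / 4) * cosh (\<beta> * (x + y - 1) / 2)
      = frank_denom \<beta> x y * K"
    unfolding cosh_field_def frank_denom_def e B_def[symmetric] K_def using pos
    by (simp add: field_simps power2_eq_square power4_eq_xxxx)
  have N: "(\<beta> / 2) * sinh (\<beta> / 2)
      = \<beta> * (1 - exp (- \<beta>)) * exp (- \<beta> * x) * exp (- \<beta> * y) * K\<^sup>2"
    unfolding sinh_field_def e K_def using pos
    by (simp add: field_simps power2_eq_square power4_eq_xxxx)
  show ?thesis
    unfolding limit_density_def using assms pos
    by (simp only: D N power_mult_distrib if_False) simp
qed

lemma limit_density_nonneg: "limit_density \<beta> x y \<ge> 0"
proof (cases "\<beta> \<ge> 0")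
  case True
  then show ?thesis by (simp add: limit_density_def)
next
  case False
  then have "\<beta> * sinh (\<beta> / 2) \<ge> 0" by (intro mult_nonpos_nonpos) auto
  then show ?thesis by (simp add: limit_density_def)
qed

lemma continuous_on_limit_density:
  "continuous_on ({0..1} \<times> {0..1}) (\<lambda>p. limit_density \<beta> (fst p) (snd p))"
proof (cases "\<beta> = 0")
  case True
  then show ?thesis by (simp add: limit_density_def)
next
  case False
  have "continuous_on ({0..1} \<times> {0..1}) (\<lambda>p. \<beta> * (1 - exp (- \<beta>)) * exp (- \<beta> * fst p)
      * exp (- \<beta> * snd p) / (frank_denom \<beta> (fst p) (snd p))\<^sup>2)"
    using False frank_denom_nonzero[OF False] unfolding frank_denom_def
    by (intro continuous_intros) auto
  then show ?thesis by (simp add: limit_density_eq[OF False])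
qed

lemma integral_limit_density_snd:
  assumes "\<beta> \<noteq> 0" "x \<in> {0..1}" "0 \<le> t"
  shows "integral {0..t} (limit_density \<beta> x)
       = exp (- \<beta> * x) * (1 - exp (- \<beta> * t)) / frank_denom \<beta> x t"
proof -
  \<comment> \<open>The antiderivative is the partial derivative of the copula in its first
    argument; it vanishes at \<open>y = 0\<close>.\<close>
  let ?F = "\<lambda>y. exp (- \<beta> * x) * (1 - exp (- \<beta> * y)) / frank_denom \<beta> x y"
  have "(limit_density \<beta> x has_integral (?F t - ?F 0)) {0..t}"
  proof (rule fundamental_theorem_of_calculus)
    fix y assume "y \<in> {0..t}"
    have nz: "frank_denom \<beta> x y \<noteq> 0" by (rule frank_denom_nonzero) fact+
    have dD: "((\<lambda>y. frank_denom \<beta> x y) has_real_derivative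
        - (1 - exp (- \<beta> * x)) * (\<beta> * exp (- \<beta> * y))) (at y within {0..t})"
      unfolding frank_denom_def by (auto intro!: derivative_eq_intros simp: algebra_simps)
    have "(?F has_real_derivative limit_density \<beta> x y) (at y within {0..t})"
      unfolding limit_density_eq[OF assms(1)]
      by (rule derivative_eq_intros dD refl nz)+
         (use nz in \<open>simp add: frank_denom_def field_simps power2_eq_square\<close>)
    then show "(?F has_vector_derivative limit_density \<beta> x y) (at y within {0..t})"
      by (simp add: has_real_derivative_iff_has_vector_derivative)
  qed fact
  then show ?thesis by (simp add: integral_unique)
qed

lemma integral_limit_density:
  assumes "s \<in> {0..1}" "t \<in> {0..1}"
  shows "integral (cbox (0, 0) (s, t)) (\<lambda>p. limit_density \<beta> (fst p) (snd p)) = frank_copula \<beta> s t"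
proof -
  have "integral (cbox (0, 0) (s, t)) (\<lambda>p. limit_density \<beta> (fst p) (snd p))
      = integral (cbox 0 s) (\<lambda>x. integral (cbox 0 t) (\<lambda>y. limit_density \<beta> x y))"
    using assms
    by (subst integral_prod_continuous)
       (auto intro!: continuous_on_subset[OF continuous_on_limit_density])
  also have "\<dots> = frank_copula \<beta> s t"
  proof (cases "\<beta> = 0")
    case True
    then show ?thesis using assms by (simp add: limit_density_def frank_copula_def)
  next
    case False
    let ?G = "\<lambda>x. frank_copula \<beta> x t"
    have "integral (cbox 0 s) (\<lambda>x. integral (cbox 0 t) (\<lambda>y. limit_density \<beta> x y))
        = integral {0..s} (\<lambda>x. exp (- \<beta> * x) * (1 - exp (- \<beta> * t)) / frank_denom \<beta> x t)"
      using assms integral_limit_density_snd[OF False]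
      by (simp add: cbox_interval) (intro integral_cong, auto)
    also have "\<dots> = ?G s - ?G 0"
    proof (intro integral_unique fundamental_theorem_of_calculus)
      fix x assume x: "x \<in> {0..s}"
      then have "x \<in> {0..1}" using assms by auto
      note pos = frank_arg_pos[OF False this, of t]
      have nz: "1 - exp (- \<beta>) \<noteq> 0" using False by simp
      have dA: "((\<lambda>x. 1 - (1 - exp (- \<beta> * x)) * (1 - exp (- \<beta> * t)) / (1 - exp (- \<beta>)))
          has_real_derivative - (\<beta> * exp (- \<beta> * x)) * (1 - exp (- \<beta> * t)) / (1 - exp (- \<beta>)))
          (at x within {0..s})"
        using nz by (auto intro!: derivative_eq_intros simp: divide_simps)
      have "(?G has_real_derivative exp (- \<beta> * x) * (1 - exp (- \<beta> * t)) / frank_denom \<beta> x t)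
          (at x within {0..s})"
        unfolding frank_copula_def frank_denom_eq[OF False] using False
        by (simp only: if_False) (rule derivative_eq_intros dA refl pos False | simp)+
      then show "(?G has_vector_derivative exp (- \<beta> * x) * (1 - exp (- \<beta> * t)) / frank_denom \<beta> x t)
          (at x within {0..s})"
        by (simp add: has_real_derivative_iff_has_vector_derivative)
    qed (use assms in auto)
    finally show ?thesis by (simp add: frank_copula_def)
  qed
  finally show ?thesis .
qed

section \<open>The law of large numbers\<close>

abbreviation (input) unit_square :: "(real \<times> real) set" where
  "unit_square \<equiv> {0..1} \<times> {0..1}"

definition empirical_mean :: "nat \<Rightarrow> (real \<times> real \<Rightarrow> real) \<Rightarrow> (nat \<Rightarrow> nat) \<Rightarrow> real" where
  "empirical_mean n g \<pi> = (1 / real n) * (\<Sum>i=1..n. g (real i / real n, real (\<pi> i) / real n))"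

definition limit_mean :: "real \<Rightarrow> (real \<times> real \<Rightarrow> real) \<Rightarrow> real" where
  "limit_mean \<beta> g = (LINT p:unit_square|lborel. g p * limit_density \<beta> (fst p) (snd p))"

definition deviation_prob :: "real \<Rightarrow> (real \<times> real \<Rightarrow> real) \<Rightarrow> real \<Rightarrow> nat \<Rightarrow> real" where
  "deviation_prob \<beta> g \<epsilon> n = measure (mallows n (1 - \<beta> / real n))
     {\<pi>. \<pi> permutes {1..n} \<and> \<bar>empirical_mean n g \<pi> - limit_mean \<beta> g\<bar> > \<epsilon>}"

text \<open>Integrability belongs to the property because the integral of a non-integrable function
  is 0 by convention, and then \<open>limit_mean\<close> would not be additive.\<close>

definition mallows_lln :: "real \<Rightarrow> (real \<times> real \<Rightarrow> real) \<Rightarrow> bool" where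
  "mallows_lln \<beta> g \<longleftrightarrow>
     set_integrable lborel unit_square (\<lambda>p. g p * limit_density \<beta> (fst p) (snd p)) \<and>
     (\<forall>\<epsilon>>0. deviation_prob \<beta> g \<epsilon> \<longlonglongrightarrow> 0)"

section \<open>Closure properties of the law of large numbers\<close>

lemma deviation_prob_nonneg: "deviation_prob \<beta> g \<epsilon> n \<ge> 0"
  by (simp add: deviation_prob_def)

lemma mallows_lln_zero: "mallows_lln \<beta> (\<lambda>_. 0)"
proof -
  have "deviation_prob \<beta> (\<lambda>_. 0) \<epsilon> = (\<lambda>_. 0)" if "\<epsilon> > 0" for \<epsilon>
    using that by (auto simp: fun_eq_iff deviation_prob_def empirical_mean_def limit_mean_def
        set_lebesgue_integral_def)
  then show ?thesis by (auto simp: mallows_lln_def set_integrable_def)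
qed

text \<open>If the sum deviates by more than \<open>\<epsilon>\<close>, one summand deviates by more
  than \<open>\<epsilon> / 2\<close>; the union bound does the rest.\<close>

lemma mallows_lln_add:
  assumes "mallows_lln \<beta> g" "mallows_lln \<beta> h"
  shows "mallows_lln \<beta> (\<lambda>p. g p + h p)"
proof -
  let ?u = "\<lambda>p. limit_density \<beta> (fst p) (snd p)"
  have int: "set_integrable lborel unit_square (\<lambda>p. g p * ?u p)"
    "set_integrable lborel unit_square (\<lambda>p. h p * ?u p)"
    using assms by (auto simp: mallows_lln_def)
  have lim: "limit_mean \<beta> (\<lambda>p. g p + h p) = limit_mean \<beta> g + limit_mean \<beta> h"
    unfolding limit_mean_def distrib_right by (rule set_integral_add(2)[OF int])
  have "deviation_prob \<beta> (\<lambda>p. g p + h p) \<epsilon> \<longlonglongrightarrow> 0" if "\<epsilon> > 0" for \<epsilon>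
  proof -
    have lim0: "(\<lambda>n. deviation_prob \<beta> g (\<epsilon> / 2) n + deviation_prob \<beta> h (\<epsilon> / 2) n) \<longlonglongrightarrow> 0"
      using assms \<open>\<epsilon> > 0\<close> by (intro tendsto_add_zero) (auto simp: mallows_lln_def)
    have le: "eventually (\<lambda>n. deviation_prob \<beta> (\<lambda>p. g p + h p) \<epsilon> n
        \<le> deviation_prob \<beta> g (\<epsilon> / 2) n + deviation_prob \<beta> h (\<epsilon> / 2) n) sequentially"
      using eventually_mallows_param_pos[of \<beta>]
    proof eventually_elim
      case (elim n)
      let ?A = "\<lambda>g \<epsilon>. {\<pi>. \<pi> permutes {1..n} \<and> \<bar>empirical_mean n g \<pi> - limit_mean \<beta> g\<bar> > \<epsilon>}"
      interpret prob_space "mallows n (1 - \<beta> / real n)" by (rule prob_space_mallows[OF elim])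
      have "\<bar>empirical_mean n (\<lambda>p. g p + h p) \<pi> - limit_mean \<beta> (\<lambda>p. g p + h p)\<bar>
          \<le> \<bar>empirical_mean n g \<pi> - limit_mean \<beta> g\<bar> + \<bar>empirical_mean n h \<pi> - limit_mean \<beta> h\<bar>" for \<pi>
        unfolding lim by (simp add: empirical_mean_def sum.distrib algebra_simps)
      then have "?A (\<lambda>p. g p + h p) \<epsilon> \<subseteq> ?A g (\<epsilon> / 2) \<union> ?A h (\<epsilon> / 2)"
        by (smt (verit, ccfv_threshold) Un_iff field_sum_of_halves mem_Collect_eq subsetI)
      then have "prob (?A (\<lambda>p. g p + h p) \<epsilon>) \<le> prob (?A g (\<epsilon> / 2) \<union> ?A h (\<epsilon> / 2))"
        by (intro finite_measure_mono) auto
      also have "\<dots> \<le> prob (?A g (\<epsilon> / 2)) + prob (?A h (\<epsilon> / 2))"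
        by (intro measure_Un_le) auto
      finally show ?case by (simp add: deviation_prob_def)
    qed
    show ?thesis
      by (rule tendsto_sandwich[OF _ le tendsto_const lim0]) (simp add: deviation_prob_nonneg)
  qed
  then show ?thesis
    using set_integral_add(1)[OF int] by (simp add: mallows_lln_def distrib_right)
qed

lemma mallows_lln_cmult:
  assumes "mallows_lln \<beta> g"
  shows "mallows_lln \<beta> (\<lambda>p. c * g p)"
proof (cases "c = 0")
  case True
  then show ?thesis by (simp add: mallows_lln_zero)
next
  case False
  have int: "set_integrable lborel unit_square (\<lambda>p. g p * limit_density \<beta> (fst p) (snd p))"
    using assms by (simp add: mallows_lln_def)
  have lim: "limit_mean \<beta> (\<lambda>p. c * g p) = c * limit_mean \<beta> g"
    unfolding limit_mean_def mult.assoc by (rule set_integral_mult_right)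
  have emp: "empirical_mean n (\<lambda>p. c * g p) \<pi> = c * empirical_mean n g \<pi>" for n \<pi>
    by (simp add: empirical_mean_def sum_distrib_left algebra_simps)
  have "(\<epsilon> < \<bar>empirical_mean n (\<lambda>p. c * g p) \<pi> - limit_mean \<beta> (\<lambda>p. c * g p)\<bar>)
      = (\<epsilon> / \<bar>c\<bar> < \<bar>empirical_mean n g \<pi> - limit_mean \<beta> g\<bar>)" for \<epsilon> n \<pi>
    using False unfolding lim emp right_diff_distrib[symmetric] abs_mult by (simp add: field_simps)
  then have "deviation_prob \<beta> (\<lambda>p. c * g p) \<epsilon> = deviation_prob \<beta> g (\<epsilon> / \<bar>c\<bar>)" for \<epsilon>
    by (simp add: deviation_prob_def fun_eq_iff)
  moreover have "set_integrable lborel unit_square (\<lambda>p. c * g p * limit_density \<beta> (fst p) (snd p))"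
    unfolding mult.assoc using int by (intro set_integrable_mult_right)
  ultimately show ?thesis
    using assms False by (simp add: mallows_lln_def)
qed

lemma mallows_lln_diff:
  assumes "mallows_lln \<beta> g" "mallows_lln \<beta> h"
  shows "mallows_lln \<beta> (\<lambda>p. g p - h p)"
  using mallows_lln_add[OF assms(1) mallows_lln_cmult[OF assms(2), of "-1"]] by simp

lemma mallows_lln_sum:
  assumes "\<And>a. a \<in> I \<Longrightarrow> mallows_lln \<beta> (g a)"
  shows "mallows_lln \<beta> (\<lambda>p. \<Sum>a\<in>I. g a p)"
  using assms
  by (induction I rule: infinite_finite_induct) (auto intro: mallows_lln_zero mallows_lln_add)

lemma compact_unit_square: "compact unit_square"
  by (intro compact_Times compact_Icc)

lemma mallows_lln_uniform_limit:
  assumes int: "set_integrable lborel unit_square (\<lambda>p. f p * limit_density \<beta> (fst p) (snd p))"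
    and approx: "\<And>\<delta>. \<delta> > 0 \<Longrightarrow> \<exists>g. mallows_lln \<beta> g \<and> (\<forall>p\<in>unit_square. \<bar>f p - g p\<bar> \<le> \<delta>)"
  shows "mallows_lln \<beta> f"
  unfolding mallows_lln_def
proof (intro conjI int allI impI)
  fix \<epsilon> :: real assume "\<epsilon> > 0"
  let ?u = "\<lambda>p. limit_density \<beta> (fst p) (snd p)"
  define I where "I = (LINT p:unit_square|lborel. ?u p)"
  have intu: "set_integrable lborel unit_square ?u"
    unfolding set_integrable_def
    by (rule borel_integrable_compact[OF compact_unit_square continuous_on_limit_density])
  have "I \<ge> 0"
    unfolding I_def set_lebesgue_integral_def
    by (intro integral_nonneg_AE) (auto simp: limit_density_nonneg)
  \<comment> \<open>Chosen so that \<open>\<delta> + \<delta> * I = \<epsilon> / 2\<close>: the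
    first summand bounds the change of the empirical mean, the second that of the limit
    mean.\<close>
  define \<delta> where "\<delta> = \<epsilon> / (2 * (1 + I))"
  have "\<delta> > 0" using \<open>\<epsilon> > 0\<close> \<open>I \<ge> 0\<close> by (simp add: \<delta>_def)
  then obtain g where g: "mallows_lln \<beta> g" "\<forall>p\<in>unit_square. \<bar>f p - g p\<bar> \<le> \<delta>"
    using approx by blast
  have intg: "set_integrable lborel unit_square (\<lambda>p. g p * ?u p)"
    using g by (simp add: mallows_lln_def)
  have "\<bar>limit_mean \<beta> f - limit_mean \<beta> g\<bar>
      = \<bar>LINT p:unit_square|lborel. f p * ?u p - g p * ?u p\<bar>"
    unfolding limit_mean_def by (subst set_integral_diff[OF int intg]) simp
  also have "\<dots> \<le> (LINT p:unit_square|lborel. \<bar>f p * ?u p - g p * ?u p\<bar>)"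
    using set_integral_norm_bound[OF set_integral_diff(1)[OF int intg]] by simp
  also have "\<dots> \<le> (LINT p:unit_square|lborel. \<delta> * ?u p)"
  proof (rule set_integral_mono)
    show "set_integrable lborel unit_square (\<lambda>p. \<bar>f p * ?u p - g p * ?u p\<bar>)"
      by (rule set_integrable_abs[OF set_integral_diff(1)[OF int intg]])
    show "set_integrable lborel unit_square (\<lambda>p. \<delta> * ?u p)"
      using intu by (intro set_integrable_mult_right)
    fix p assume "p \<in> unit_square"
    then show "\<bar>f p * ?u p - g p * ?u p\<bar> \<le> \<delta> * ?u p"
      using g(2) unfolding left_diff_distrib[symmetric] abs_mult
      by (auto simp: limit_density_nonneg intro!: mult_right_mono)
  qed
  also have "\<dots> = \<delta> * I" unfolding I_def by (rule set_integral_mult_right)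
  finally have lim: "\<bar>limit_mean \<beta> f - limit_mean \<beta> g\<bar> \<le> \<delta> * I" .
  have half: "\<delta> + \<delta> * I = \<epsilon> / 2" using \<open>I \<ge> 0\<close> by (simp add: \<delta>_def divide_simps) (simp add: algebra_simps)
  have le: "eventually (\<lambda>n. deviation_prob \<beta> f \<epsilon> n \<le> deviation_prob \<beta> g (\<epsilon> / 2) n) sequentially"
    using eventually_mallows_param_pos[of \<beta>] eventually_gt_at_top[of 0]
  proof eventually_elim
    case (elim n)
    show ?case
      unfolding deviation_prob_def
    proof (intro measure_mallows_mono elim(1) subsetI)
      fix \<pi> assume "\<pi> \<in> {\<pi>. \<pi> permutes {1..n} \<and> \<epsilon> < \<bar>empirical_mean n f \<pi> - limit_mean \<beta> f\<bar>}"
      then have \<pi>: "\<pi> permutes {1..n}" "\<epsilon> < \<bar>empirical_mean n f \<pi> - limit_mean \<beta> f\<bar>" by auto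
      have "\<bar>empirical_mean n f \<pi> - empirical_mean n g \<pi>\<bar>
          = \<bar>\<Sum>i=1..n. f (real i / real n, real (\<pi> i) / real n) - g (real i / real n, real (\<pi> i) / real n)\<bar> / real n"
        by (simp add: empirical_mean_def sum_subtractf flip: diff_divide_distrib)
      also have "\<dots> \<le> (\<Sum>i=1..n. \<delta>) / real n"
      proof (intro divide_right_mono order_trans[OF sum_abs] sum_mono)
        fix i assume i: "i \<in> {1..n}"
        then have "\<pi> i \<in> {1..n}" using \<pi>(1) by (simp only: permutes_in_image)
        then have "(real i / real n, real (\<pi> i) / real n) \<in> unit_square" using i elim by auto
        then show "\<bar>f (real i / real n, real (\<pi> i) / real n) - g (real i / real n, real (\<pi> i) / real n)\<bar> \<le> \<delta>"
          using g(2) by blast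
      qed auto
      also have "\<dots> = \<delta>" using elim by simp
      finally have "\<epsilon> / 2 < \<bar>empirical_mean n g \<pi> - limit_mean \<beta> g\<bar>"
        using \<pi>(2) lim half by linarith
      then show "\<pi> \<in> {\<pi>. \<pi> permutes {1..n} \<and> \<epsilon> / 2 < \<bar>empirical_mean n g \<pi> - limit_mean \<beta> g\<bar>}"
        using \<pi>(1) by simp
    qed auto
  qed
  have lim0: "deviation_prob \<beta> g (\<epsilon> / 2) \<longlonglongrightarrow> 0"
    using g(1) \<open>\<epsilon> > 0\<close> by (simp add: mallows_lln_def)
  show "deviation_prob \<beta> f \<epsilon> \<longlonglongrightarrow> 0"
    by (rule tendsto_sandwich[OF _ le tendsto_const lim0]) (simp add: deviation_prob_nonneg)
qed

section \<open>The case of quadrants\<close>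

text \<open>There is no cut-off at 0 from below: with a negative threshold the function vanishes on
  the unit square, so grid cells at the boundary are differences of quadrants like all
  others.\<close>

definition quadrant :: "real \<Rightarrow> real \<Rightarrow> real \<times> real \<Rightarrow> real" where
  "quadrant s t p = of_bool (fst p \<le> s \<and> snd p \<le> t)"

lemma set_integral_quadrant:
  assumes "s \<in> {0..1}" "t \<in> {0..1}"
  shows "set_integrable lborel unit_square (\<lambda>p. quadrant s t p * limit_density \<beta> (fst p) (snd p))"
    and "limit_mean \<beta> (quadrant s t) = frank_copula \<beta> s t"
proof -
  let ?u = "\<lambda>p. limit_density \<beta> (fst p) (snd p)"
  have cont: "continuous_on (cbox (0, 0) (s, t)) ?u"
    by (rule continuous_on_subset[OF continuous_on_limit_density]) (use assms in auto)
  have eq: "(\<lambda>p. indicator unit_square p *\<^sub>R (quadrant s t p * ?u p)) = (\<lambda>p. indicator (cbox (0, 0) (s, t)) p *\<^sub>R ?u p)"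
    using assms by (auto simp: fun_eq_iff quadrant_def indicator_def)
  have int: "set_integrable lborel (cbox (0, 0) (s, t)) ?u"
    unfolding set_integrable_def by (rule borel_integrable_compact[OF compact_cbox cont])
  then show "set_integrable lborel unit_square (\<lambda>p. quadrant s t p * ?u p)"
    unfolding set_integrable_def eq .
  have "limit_mean \<beta> (quadrant s t) = (LINT p:cbox (0, 0) (s, t)|lborel. ?u p)"
    unfolding limit_mean_def set_lebesgue_integral_def eq ..
  also have "\<dots> = frank_copula \<beta> s t"
    using set_borel_integral_eq_integral(2)[OF int] integral_limit_density[OF assms] by simp
  finally show "limit_mean \<beta> (quadrant s t) = frank_copula \<beta> s t" .
qed

lemma frank_copula_nonneg:
  assumes "s \<in> {0..1}" "t \<in> {0..1}"
  shows "0 \<le> frank_copula \<beta> s t"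
  unfolding integral_limit_density[OF assms, symmetric]
  by (intro integral_nonneg integrable_continuous continuous_on_subset[OF continuous_on_limit_density])
     (use assms in \<open>auto simp: limit_density_nonneg\<close>)

text \<open>As the integral of a nonnegative density the copula grows with \<open>s\<close>, and at
  \<open>s = 1\<close> the marginal is uniform. Together with nonnegativity this puts
  \<open>t - frank_copula \<beta> s t\<close> into the unit interval.\<close>

lemma frank_copula_le:
  assumes "s \<in> {0..1}" "t \<in> {0..1}"
  shows "frank_copula \<beta> s t \<le> t"
proof -
  have one: "(1::real) \<in> {0..1}" by simp
  have "frank_copula \<beta> s t \<le> frank_copula \<beta> 1 t"
    unfolding integral_limit_density[OF assms, symmetric] integral_limit_density[OF one assms(2), symmetric]
    by (intro integral_subset_le integrable_continuous continuous_on_subset[OF continuous_on_limit_density])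
       (use assms in \<open>auto simp: limit_density_nonneg\<close>)
  also have "\<dots> = t" by (simp add: frank_copula_def)
  finally show ?thesis .
qed

text \<open>This identifies the copula: solving the limit equation for the mass with first
  coordinate beyond \<open>s\<close> and second at most \<open>t\<close> gives
  \<open>t - frank_copula \<beta> s t\<close>. Exponentiation removes the logarithm, and a rational
  identity in \<open>T\<close>, \<open>S\<close>, \<open>c\<close> remains.\<close>

lemma qint_lim_frank_copula:
  assumes "s \<in> {0..1}"
  shows "qint_lim (- \<beta>) (t - frank_copula \<beta> s t)
       = qint_lim (- \<beta>) t * exp (- \<beta> * s) * qint_lim \<beta> (1 - s) / qint_lim \<beta> 1"
proof (cases "\<beta> = 0")
  case True
  then show ?thesis by (simp add: qint_lim_def frank_copula_def algebra_simps)
next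
  case False
  define A where "A = 1 - (1 - exp (- \<beta> * s)) * (1 - exp (- \<beta> * t)) / (1 - exp (- \<beta>))"
  have "A > 0" unfolding A_def using frank_arg_pos[OF False assms] .
  define T where "T = exp (\<beta> * t)"
  define S where "S = exp (- \<beta> * s)"
  define c where "c = 1 - exp (- \<beta>)"
  have pos: "T > 0" "S > 0" "c \<noteq> 0" using False by (simp_all add: T_def S_def c_def)
  have A: "A = 1 - (1 - S) * (1 - 1 / T) / c"
    by (simp add: A_def S_def T_def c_def exp_minus inverse_eq_divide)
  have "\<beta> * (t - frank_copula \<beta> s t) = \<beta> * t + ln A"
    using False by (simp add: frank_copula_def A_def algebra_simps)
  then have "exp (\<beta> * (t - frank_copula \<beta> s t)) = T * A"
    using \<open>A > 0\<close> by (simp add: exp_add T_def)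
  then have 1: "qint_lim (- \<beta>) (t - frank_copula \<beta> s t) = (T * A - 1) / \<beta>"
    using False by (simp add: qint_lim_def field_simps)
  have 2: "qint_lim (- \<beta>) t = (T - 1) / \<beta>" and 3: "qint_lim \<beta> 1 = c / \<beta>"
    using False by (simp_all add: qint_lim_def T_def c_def field_simps)
  have "exp (- \<beta> * (1 - s)) = (1 - c) / S"
    by (simp add: S_def c_def algebra_simps flip: exp_diff)
  then have 4: "qint_lim \<beta> (1 - s) = (1 - (1 - c) / S) / \<beta>"
    using False unfolding qint_lim_def by (simp only: if_False)
  show ?thesis
    unfolding 1 2 3 4 S_def[symmetric] A using False pos
    by (simp add: divide_simps) (simp add: algebra_simps)
qed

lemma le_nat_floor_iff:
  assumes "n > 0" "s \<ge> 0"
  shows "real j / real n \<le> s \<longleftrightarrow> j \<le> nat \<lfloor>real n * s\<rfloor>"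
proof -
  have "real j / real n \<le> s \<longleftrightarrow> real j \<le> real n * s"
    using assms by (simp add: field_simps)
  also have "\<dots> \<longleftrightarrow> j \<le> nat \<lfloor>real n * s\<rfloor>"
    using assms by (simp add: le_nat_iff le_floor_iff)
  finally show ?thesis .
qed

text \<open>Exactly \<open>m\<close> positions carry a value up to \<open>m\<close>, and those
  beyond \<open>i\<close> are the ones counted by \<open>tail_count\<close>.\<close>

lemma empirical_mean_quadrant:
  assumes "\<pi> permutes {1..n}" "n > 0" "0 \<le> s" "0 \<le> t" "t \<le> 1"
  shows "empirical_mean n (quadrant s t) \<pi>
       = (real (nat \<lfloor>real n * t\<rfloor>) - real (tail_count n (nat \<lfloor>real n * s\<rfloor>) (nat \<lfloor>real n * t\<rfloor>) \<pi>)) / real n"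
proof -
  define i where "i = nat \<lfloor>real n * s\<rfloor>"
  define m where "m = nat \<lfloor>real n * t\<rfloor>"
  have "real n * t \<le> real n" using assms by (simp add: mult_left_le)
  then have "m \<le> n" unfolding m_def by linarith
  let ?A = "{j \<in> {1..n}. j \<le> i \<and> \<pi> j \<le> m}"
  have "(\<Sum>j=1..n. quadrant s t (real j / real n, real (\<pi> j) / real n)) = (\<Sum>j=1..n. of_bool (j \<le> i \<and> \<pi> j \<le> m))"
    using assms by (intro sum.cong) (auto simp: quadrant_def le_nat_floor_iff i_def m_def)
  also have "\<dots> = real (card ?A)" by (simp add: Int_def)
  finally have sum: "(\<Sum>j=1..n. quadrant s t (real j / real n, real (\<pi> j) / real n)) = real (card ?A)" .
  have "card ?A + tail_count n i m \<pi> = card (?A \<union> {j \<in> {i<..n}. \<pi> j \<le> m})"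
    unfolding tail_count_def by (intro card_Un_disjoint[symmetric]) auto
  also have "?A \<union> {j \<in> {i<..n}. \<pi> j \<le> m} = {j \<in> {1..n}. \<pi> j \<le> m}" by auto
  also have "card \<dots> = card (\<pi> ` {j \<in> {1..n}. \<pi> j \<le> m})"
    using permutes_inj_on[OF assms(1)] by (intro card_image[symmetric])
  also have "\<pi> ` {j \<in> {1..n}. \<pi> j \<le> m} = \<pi> ` {1..n} \<inter> {..m}" by auto
  also have "\<pi> ` {1..n} = {1..n}" by (rule permutes_image[OF assms(1)])
  also have "{1..n} \<inter> {..m} = {1..m}" using \<open>m \<le> n\<close> by auto
  finally have "real (card ?A) = real m - real (tail_count n i m \<pi>)" by simp
  then show ?thesis unfolding empirical_mean_def sum by (simp add: i_def m_def)
qed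

lemma mallows_lln_quadrant:
  assumes "s \<le> 1" "t \<le> 1"
  shows "mallows_lln \<beta> (quadrant s t)"
proof (cases "0 \<le> s \<and> 0 \<le> t")
  case False
  then have 0: "quadrant s t p = 0" if "p \<in> unit_square" for p
    using that by (auto simp: quadrant_def)
  have ind: "(\<lambda>p. indicator unit_square p *\<^sub>R (quadrant s t p * limit_density \<beta> (fst p) (snd p))) = (\<lambda>p. 0)"
    using 0 by (auto simp: indicator_def fun_eq_iff)
  moreover have "empirical_mean n (quadrant s t) \<pi> = 0" for n \<pi>
  proof -
    have "quadrant s t (real j / real n, real (\<pi> j) / real n) = 0" for j
    proof -
      have "0 \<le> real j / real n" "0 \<le> real (\<pi> j) / real n" by simp_all
      then have "\<not> (real j / real n \<le> s \<and> real (\<pi> j) / real n \<le> t)"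
        using False by (meson order.trans)
      then show ?thesis by (simp add: quadrant_def)
    qed
    then show ?thesis by (simp add: empirical_mean_def)
  qed
  ultimately have "deviation_prob \<beta> (quadrant s t) \<epsilon> = (\<lambda>_. 0)" if "\<epsilon> > 0" for \<epsilon>
    using that by (auto simp: fun_eq_iff deviation_prob_def limit_mean_def set_lebesgue_integral_def ind
        simp del: real_scaleR_def)
  then show ?thesis using ind by (auto simp: mallows_lln_def set_integrable_def)
next
  case True
  then have st: "s \<in> {0..1}" "t \<in> {0..1}" using assms by auto
  define i where "i = (\<lambda>n. nat \<lfloor>real n * s\<rfloor>)"
  define m where "m = (\<lambda>n. nat \<lfloor>real n * t\<rfloor>)"
  define \<mu> where "\<mu> = t - frank_copula \<beta> s t"
  have le: "nat \<lfloor>real n * z\<rfloor> \<le> n" if "z \<in> {0..1}" for n z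
  proof -
    have "real n * z \<le> real n" using that by (simp add: mult_left_le)
    then show ?thesis by linarith
  qed
  have lim: "(\<lambda>n. real (i n) / real n) \<longlonglongrightarrow> s" "(\<lambda>n. real (m n) / real n) \<longlonglongrightarrow> t"
    unfolding i_def m_def using True by (simp_all only: tendsto_nat_floor_div)
  show ?thesis
    unfolding mallows_lln_def
  proof (intro conjI allI impI set_integral_quadrant st)
    fix \<epsilon> :: real assume "\<epsilon> > 0"
    have conc: "(\<lambda>n. measure (mallows n (1 - \<beta> / real n))
      {\<pi>. \<pi> permutes {1..n} \<and> \<bar>real (tail_count n (i n) (m n) \<pi>) / real n - \<mu>\<bar> > \<epsilon> / 2}) \<longlonglongrightarrow> 0"
    proof (rule tail_count_concentration[OF _ _ lim])
      show "0 \<le> \<mu>" "\<mu> \<le> 1"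
        using frank_copula_nonneg[OF st, of \<beta>] frank_copula_le[OF st, of \<beta>] assms by (auto simp: \<mu>_def)
      show "qint_lim (- \<beta>) \<mu> = qint_lim (- \<beta>) t * exp (- \<beta> * s) * qint_lim \<beta> (1 - s) / qint_lim \<beta> 1"
        unfolding \<mu>_def by (rule qint_lim_frank_copula[OF st(1)])
    qed (use le st \<open>\<epsilon> > 0\<close> in \<open>auto simp: i_def m_def\<close>)
    \<comment> \<open>One half of \<open>\<epsilon>\<close> absorbs the rounding of
      \<open>n * t\<close>, the other is left to the tail count.\<close>
    have m_ev: "eventually (\<lambda>n. \<bar>real (m n) / real n - t\<bar> < \<epsilon> / 2) sequentially"
      using tendstoD[OF lim(2), of "\<epsilon> / 2"] \<open>\<epsilon> > 0\<close> by (simp add: dist_real_def)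
    have "eventually (\<lambda>n. deviation_prob \<beta> (quadrant s t) \<epsilon> n \<le> measure (mallows n (1 - \<beta> / real n))
      {\<pi>. \<pi> permutes {1..n} \<and> \<bar>real (tail_count n (i n) (m n) \<pi>) / real n - \<mu>\<bar> > \<epsilon> / 2}) sequentially"
      using m_ev eventually_mallows_param_pos[of \<beta>] eventually_gt_at_top[of 0]
    proof eventually_elim
      case (elim n)
      show ?case
        unfolding deviation_prob_def
      proof (intro measure_mallows_mono elim(2) subsetI)
        fix \<pi> assume "\<pi> \<in> {\<pi>. \<pi> permutes {1..n} \<and>
          \<epsilon> < \<bar>empirical_mean n (quadrant s t) \<pi> - limit_mean \<beta> (quadrant s t)\<bar>}"
        then have \<pi>: "\<pi> permutes {1..n}"
          and "\<epsilon> < \<bar>empirical_mean n (quadrant s t) \<pi> - limit_mean \<beta> (quadrant s t)\<bar>" by auto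
        then have "\<epsilon> < \<bar>(real (m n) / real n - real (tail_count n (i n) (m n) \<pi>) / real n) - (t - \<mu>)\<bar>"
          using True assms elim
          by (simp add: empirical_mean_quadrant set_integral_quadrant(2)[OF st] i_def m_def \<mu>_def
              diff_divide_distrib)
        then have "\<epsilon> / 2 < \<bar>real (tail_count n (i n) (m n) \<pi>) / real n - \<mu>\<bar>"
          using elim(1) by linarith
        then show "\<pi> \<in> {\<pi>. \<pi> permutes {1..n} \<and>
          \<bar>real (tail_count n (i n) (m n) \<pi>) / real n - \<mu>\<bar> > \<epsilon> / 2}"
          using \<pi> by auto
      qed auto
    qed
    from tendsto_sandwich[OF _ this tendsto_const conc]
    show "deviation_prob \<beta> (quadrant s t) \<epsilon> \<longlonglongrightarrow> 0" by (simp add: deviation_prob_nonneg)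
  qed
qed

section \<open>Grid approximation of continuous functions\<close>

text \<open>The difference is the indicator of the cell from \<open>(a - 1) / K\<close> exclusive to
  \<open>a / K\<close> inclusive. The point \<open>x = 0\<close> falls into the cell
  \<open>a = 0\<close>, whose lower threshold is negative.\<close>

lemma of_bool_cell:
  assumes "K > 0" "0 \<le> x"
  shows "of_bool (x \<le> real a / real K) - of_bool (x \<le> (real a - 1) / real K)
       = (of_bool (a = nat \<lceil>real K * x\<rceil>) :: real)"
proof -
  have 1: "x \<le> real a / real K \<longleftrightarrow> \<lceil>real K * x\<rceil> \<le> int a"
    using assms by (simp add: field_simps ceiling_le_iff)
  have "x \<le> (real a - 1) / real K \<longleftrightarrow> real K * x \<le> of_int (int a - 1)"
    using assms by (simp add: field_simps)
  then have 2: "x \<le> (real a - 1) / real K \<longleftrightarrow> \<lceil>real K * x\<rceil> \<le> int a - 1"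
    by (simp only: ceiling_le_iff)
  have "0 \<le> \<lceil>real K * x\<rceil>" using assms by (metis ceiling_mono ceiling_zero mult_nonneg_nonneg of_nat_0_le_iff)
  then show ?thesis unfolding 1 2 by (auto simp: of_bool_def)
qed

lemma mallows_lln_continuous:
  assumes "continuous_on unit_square f"
  shows "mallows_lln \<beta> f"
proof (rule mallows_lln_uniform_limit)
  show "set_integrable lborel unit_square (\<lambda>p. f p * limit_density \<beta> (fst p) (snd p))"
    unfolding set_integrable_def
    by (intro borel_integrable_compact compact_unit_square continuous_on_mult assms
        continuous_on_limit_density)
  fix \<delta> :: real assume "\<delta> > 0"
  have "uniformly_continuous_on unit_square f"
    by (intro compact_uniformly_continuous assms compact_unit_square)
  then obtain d where d: "d > 0" "\<And>p p'. p \<in> unit_square \<Longrightarrow> p' \<in> unit_square \<Longrightarrow> dist p' p < d \<Longrightarrow> dist (f p') (f p) < \<delta>"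
    unfolding uniformly_continuous_on_def using \<open>\<delta> > 0\<close> by metis
  \<comment> \<open>Each coordinate of a point is within \<open>1 / K\<close> of its grid corner, so
    the distance to the corner is at most \<open>2 / K\<close>.\<close>
  obtain K where K: "K > 0" "2 / real K < d"
    using reals_Archimedean2[of "2 / d"] d(1)
    by (metis divide_less_eq mult.commute of_nat_0_less_iff order_less_trans zero_less_divide_iff zero_less_numeral)
  \<comment> \<open>Inclusion-exclusion over four quadrants gives the indicator of a cell, on which
    \<open>g\<close> takes the value of \<open>f\<close> at the upper right corner. The indices
    start at 0 to catch points with a zero coordinate.\<close>
  define g where "g = (\<lambda>p. \<Sum>a\<in>{..K}. \<Sum>b\<in>{..K}. f (real a / real K, real b / real K)
    * ((quadrant (real a / real K) (real b / real K) p - quadrant ((real a - 1) / real K) (real b / real K) p)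
     - (quadrant (real a / real K) ((real b - 1) / real K) p
        - quadrant ((real a - 1) / real K) ((real b - 1) / real K) p)))"
  have "mallows_lln \<beta> g"
    unfolding g_def using K
    by (intro mallows_lln_sum mallows_lln_cmult mallows_lln_diff mallows_lln_quadrant)
       (auto simp: divide_simps)
  moreover have "\<bar>f p - g p\<bar> \<le> \<delta>" if p: "p \<in> unit_square" for p
  proof -
    obtain x y where xy: "p = (x, y)" "0 \<le> x" "x \<le> 1" "0 \<le> y" "y \<le> 1" using p by auto
    define a0 where "a0 = nat \<lceil>real K * x\<rceil>"
    define b0 where "b0 = nat \<lceil>real K * y\<rceil>"
    have ceil: "nat \<lceil>real K * z\<rceil> \<le> K" "\<bar>real (nat \<lceil>real K * z\<rceil>) / real K - z\<bar> \<le> 1 / real K"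
      if "0 \<le> z" "z \<le> 1" for z
    proof -
      have "real K * z \<le> real K" "0 \<le> real K * z" using that by (simp_all add: mult_left_le)
      then show "nat \<lceil>real K * z\<rceil> \<le> K" by linarith
      have "\<bar>real (nat \<lceil>real K * z\<rceil>) - real K * z\<bar> \<le> 1" using \<open>0 \<le> real K * z\<close> by linarith
      then have "\<bar>real (nat \<lceil>real K * z\<rceil>) - real K * z\<bar> / real K \<le> 1 / real K"
        by (intro divide_right_mono) auto
      moreover have "\<bar>real (nat \<lceil>real K * z\<rceil>) - real K * z\<bar> / real K
          = \<bar>real (nat \<lceil>real K * z\<rceil>) / real K - z\<bar>"
      proof -
        have "real (nat \<lceil>real K * z\<rceil>) / real K - z = (real (nat \<lceil>real K * z\<rceil>) - real K * z) / real K"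
          using K(1) by (simp add: field_simps)
        then show ?thesis by simp
      qed
      ultimately show "\<bar>real (nat \<lceil>real K * z\<rceil>) / real K - z\<bar> \<le> 1 / real K" by simp
    qed
    have "g p = (\<Sum>a\<in>{..K}. \<Sum>b\<in>{..K}. f (real a / real K, real b / real K)
        * ((of_bool (x \<le> real a / real K) - of_bool (x \<le> (real a - 1) / real K))
         * (of_bool (y \<le> real b / real K) - of_bool (y \<le> (real b - 1) / real K))))"
      unfolding g_def quadrant_def xy(1) fst_conv snd_conv of_bool_conj
      by (intro sum.cong refl arg_cong2[where f = "(*)"]) (simp add: algebra_simps)
    also have "\<dots> = (\<Sum>a\<in>{..K}. \<Sum>b\<in>{..K}. if b = b0 then (if a = a0 then f (real a / real K, real b / real K) else 0) else 0)"
      unfolding of_bool_cell[OF K(1) xy(2)] of_bool_cell[OF K(1) xy(4)] a0_def[symmetric] b0_def[symmetric]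
      by (intro sum.cong) auto
    also have "\<dots> = f (real a0 / real K, real b0 / real K)"
      using ceil(1)[OF xy(2,3)] ceil(1)[OF xy(4,5)] by (simp add: a0_def b0_def sum.delta)
    finally have g: "g p = f (real a0 / real K, real b0 / real K)" .
    have "dist (real a0 / real K, real b0 / real K) p \<le> \<bar>real a0 / real K - x\<bar> + \<bar>real b0 / real K - y\<bar>"
      unfolding xy(1) dist_Pair_Pair dist_real_def using sqrt_sum_squares_le_sum_abs by simp
    also have "\<dots> \<le> 1 / real K + 1 / real K"
      unfolding a0_def b0_def by (intro add_mono ceil xy)
    also have "\<dots> < d" using K(2) by simp
    finally have "dist (real a0 / real K, real b0 / real K) p < d" .
    moreover have "(real a0 / real K, real b0 / real K) \<in> unit_square"
      using ceil(1)[OF xy(2,3)] ceil(1)[OF xy(4,5)] K(1) by (auto simp: a0_def b0_def)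
    ultimately have "dist (f (real a0 / real K, real b0 / real K)) (f p) < \<delta>" using d(2)[OF p] by blast
    then show ?thesis using g by (simp add: dist_real_def abs_minus_commute)
  qed
  ultimately show "\<exists>g. mallows_lln \<beta> g \<and> (\<forall>p\<in>unit_square. \<bar>f p - g p\<bar> \<le> \<delta>)" by blast
qed

theorem theorem1p1:
  fixes \<beta> :: real and f :: "real \<times> real \<Rightarrow> real"
  assumes "continuous_on ({0..1} \<times> {0..1}) f"
  shows "\<exists>L :: real \<Rightarrow> real.
    (\<forall>\<epsilon>>0. (\<lambda>n. measure (mallows n (1 - \<beta> / real n))
        {\<pi>. \<pi> permutes {1..n} \<and>
           \<bar>(1 / real n) * (\<Sum>i=1..n. f (real i / real n, real (\<pi> i) / real n))
             - (LINT p:{0..1} \<times> {0..1}|lborel. f p * limit_density \<beta> (fst p) (snd p))\<bar> > \<epsilon>})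
      \<longlonglongrightarrow> L \<epsilon>) \<and>
    (L \<longlongrightarrow> 0) (at_right 0)"
proof (intro exI conjI allI impI)
  \<comment> \<open>The witness \<open>L\<close> is still schematic here; the limit shown below
    makes it the constant zero function.\<close>
  fix \<epsilon> :: real assume "\<epsilon> > 0"
  then have "deviation_prob \<beta> f \<epsilon> \<longlonglongrightarrow> 0"
    using mallows_lln_continuous[OF assms] by (simp add: mallows_lln_def)
  then show "(\<lambda>n. measure (mallows n (1 - \<beta> / real n))
        {\<pi>. \<pi> permutes {1..n} \<and>
           \<bar>(1 / real n) * (\<Sum>i=1..n. f (real i / real n, real (\<pi> i) / real n))
             - (LINT p:{0..1} \<times> {0..1}|lborel. f p * limit_density \<beta> (fst p) (snd p))\<bar> > \<epsilon>})
      \<longlonglongrightarrow> 0"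
    unfolding deviation_prob_def empirical_mean_def limit_mean_def .
qed (rule tendsto_const)

end
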